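(* Let $n\ge 1$, let $\Omega\subset\mathbb{R}^n$ be a bounded domain of class $C^{2+\nu}$ for some $\nu>0$, let $p>0$, and let $f:\overline\Omega\to[0,\infty)$ be a nonnegative Hölder continuous function with $f\not\equiv 0$. Let $u$ be the unique maximal classical solution, with maximal existence time $T$, of $$u_t=\Delta u+f(x)(1-u)^{-p}\ \ (x\in\Omega,\ t>0),\qquad u=0\ \ (x\in\partial\Omega,\ t>0),\qquad u(x,0)=0\ \ (x\in\Omega),$$ and assume $T<\infty$. Then there exists a constant $\gamma>0$, independent of $x$ and $t$, such that $$1-u(x,t)\ \ge\ \gamma\,\delta(x)\,(T-t)^{1/(p+1)}\qquad\text{for all } x\in\Omega,\ 0<t<T,$$ where $\delta(x)=\mathrm{dist}(x,\partial\Omega)$.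
   Context: The problem has a unique classical solution $u$ (with $u<1$) on a short time interval, and it can be continued as long as $\max_{x\in\overline\Omega}u(x,t)<1$. $[0,T)$, $T\le\infty$, denotes its maximal existence interval. If $T<\infty$ then $\limsup_{t\to T^-}\max_{x\in\overline\Omega}u(x,t)=1$ (finite-time quenching). *)

theory Defs
  imports "HOL-Analysis.Analysis"
begin

definition partial_differentiable :: "'a::euclidean_space \<Rightarrow> ('a \<Rightarrow> real) \<Rightarrow> 'a \<Rightarrow> bool" where
  "partial_differentiable b g x \<longleftrightarrow> (\<lambda>s. g (x + s *\<^sub>R b)) field_differentiable (at 0)"

definition partial_deriv :: "'a::euclidean_space \<Rightarrow> ('a \<Rightarrow> real) \<Rightarrow> 'a \<Rightarrow> real" where
  "partial_deriv b g x = deriv (\<lambda>s. g (x + s *\<^sub>R b)) 0"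

definition laplacian :: "('a::euclidean_space \<Rightarrow> real) \<Rightarrow> 'a \<Rightarrow> real" where
  "laplacian g x = (\<Sum>b\<in>Basis. partial_deriv b (partial_deriv b g) x)"

definition holder_on :: "real \<Rightarrow> 'a::metric_space set \<Rightarrow> ('a \<Rightarrow> real) \<Rightarrow> bool" where
  "holder_on \<alpha> S g \<longleftrightarrow> (\<exists>C. \<forall>x\<in>S. \<forall>y\<in>S. \<bar>g x - g y\<bar> \<le> C * dist x y powr \<alpha>)"

text \<open>The two predicates below are meant for open sets only: the partial derivatives at a point
  are then determined by the values in the set.\<close>

definition C2_holder_on :: "real \<Rightarrow> 'a::euclidean_space set \<Rightarrow> ('a \<Rightarrow> real) \<Rightarrow> bool" where
  "C2_holder_on \<nu> S g \<longleftrightarrow> continuous_on S g \<and>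
     (\<forall>i\<in>Basis. (\<forall>x\<in>S. partial_differentiable i g x) \<and> continuous_on S (partial_deriv i g) \<and>
       (\<forall>j\<in>Basis. (\<forall>x\<in>S. partial_differentiable j (partial_deriv i g) x) \<and>
          continuous_on S (partial_deriv j (partial_deriv i g)) \<and>
          holder_on \<nu> S (partial_deriv j (partial_deriv i g))))"

definition C21_on :: "('a::euclidean_space \<times> real) set \<Rightarrow> ('a \<Rightarrow> real \<Rightarrow> real) \<Rightarrow> bool" where
  "C21_on Q u \<longleftrightarrow>
     continuous_on Q (\<lambda>(x, t). u x t) \<and>
     (\<forall>(x, t)\<in>Q. u x field_differentiable (at t)) \<and>
     continuous_on Q (\<lambda>(x, t). deriv (u x) t) \<and>
     (\<forall>i\<in>Basis.
        (\<forall>(x, t)\<in>Q. partial_differentiable i (\<lambda>y. u y t) x) \<and>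
        continuous_on Q (\<lambda>(x, t). partial_deriv i (\<lambda>y. u y t) x) \<and>
        (\<forall>j\<in>Basis.
           (\<forall>(x, t)\<in>Q. partial_differentiable j (partial_deriv i (\<lambda>y. u y t)) x) \<and>
           continuous_on Q (\<lambda>(x, t). partial_deriv j (partial_deriv i (\<lambda>y. u y t)) x)))"

text \<open>Class \<open>C\<^sup>2\<^sup>+\<^sup>\<nu>\<close> with \<open>0 < \<nu> \<le> 1\<close>: near each boundary point, the open set lies strictly on one
  side of the graph of a \<open>C\<^sup>2\<^sup>+\<^sup>\<nu>\<close> function over the hyperplane orthogonal to a unit vector \<open>e\<close>.
  A function on that hyperplane is encoded as a function on the whole space that is constant in
  direction \<open>e\<close>.\<close>

definition C2_holder_boundary :: "real \<Rightarrow> 'a::euclidean_space set \<Rightarrow> bool" where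
  "C2_holder_boundary \<nu> \<Omega> \<longleftrightarrow>
     (\<forall>z\<in>frontier \<Omega>. \<exists>r>0. \<exists>e \<phi>. norm e = 1 \<and>
        (\<forall>x s. \<phi> (x + s *\<^sub>R e) = \<phi> x) \<and>
        C2_holder_on \<nu> (ball z r) \<phi> \<and>
        \<Omega> \<inter> ball z r = {x \<in> ball z r. \<phi> x < x \<bullet> e})"

definition classical_solution ::
  "'a::euclidean_space set \<Rightarrow> real \<Rightarrow> ('a \<Rightarrow> real) \<Rightarrow> ('a \<Rightarrow> real \<Rightarrow> real) \<Rightarrow> ereal \<Rightarrow> bool" where
  "classical_solution \<Omega> p f u T \<longleftrightarrow>
     0 < T \<and>
     continuous_on (closure \<Omega> \<times> {t. 0 \<le> t \<and> ereal t < T}) (\<lambda>(x, t). u x t) \<and>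
     C21_on (\<Omega> \<times> {t. 0 < t \<and> ereal t < T}) u \<and>
     (\<forall>x\<in>closure \<Omega>. \<forall>t. 0 \<le> t \<and> ereal t < T \<longrightarrow> u x t < 1) \<and>
     (\<forall>x\<in>\<Omega>. \<forall>t. 0 < t \<and> ereal t < T \<longrightarrow>
        deriv (u x) t = laplacian (\<lambda>y. u y t) x + f x * (1 - u x t) powr (- p)) \<and>
     (\<forall>x\<in>frontier \<Omega>. \<forall>t. 0 < t \<and> ereal t < T \<longrightarrow> u x t = 0) \<and>
     (\<forall>x\<in>\<Omega>. u x 0 = 0)"

definition maximal_classical_solution ::
  "'a::euclidean_space set \<Rightarrow> real \<Rightarrow> ('a \<Rightarrow> real) \<Rightarrow> ('a \<Rightarrow> real \<Rightarrow> real) \<Rightarrow> ereal \<Rightarrow> bool" where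
  "maximal_classical_solution \<Omega> p f u T \<longleftrightarrow>
     classical_solution \<Omega> p f u T \<and>
     \<not> (\<exists>v T'. T < T' \<and> classical_solution \<Omega> p f v T' \<and>
          (\<forall>x\<in>closure \<Omega>. \<forall>t. 0 \<le> t \<and> ereal t < T \<longrightarrow> v x t = u x t))"

end

theory Submission
  imports Defs
begin

text \<open>Write \<open>w = 1 - u\<close> and compare the increment \<open>u(x, t + h) - u(x, t)\<close> with
  \<open>h \<psi>\<^sup>p\<^sup>+\<^sup>1 w\<^sup>-\<^sup>p\<close>, where \<open>\<psi>\<close> is a subsolution of the heat equation. Because
  \<open>(\<psi>, w) \<mapsto> \<psi>\<^sup>p\<^sup>+\<^sup>1 w\<^sup>-\<^sup>p\<close> is convex and homogeneous of degree one, the inequality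
  propagates from the parabolic boundary to the interior by the minimum principle (a version of the
  Friedman-McLeod method for time increments, which needs no regularity of \<open>u\<^sub>t\<close>). Explicit
  barriers \<open>\<psi>\<close> on balls carry positivity from a ball on which \<open>f > 0\<close> to all of \<open>\<Omega>\<close>, and on
  interior tangent balls they vanish linearly at the boundary, so for
  \<open>t \<ge> T / 2\<close> the inequality holds with \<open>C \<delta>(x)\<close> in place of \<open>\<psi>\<close>. Letting \<open>h\<close> tend to \<open>T - t\<close> gives
  \<open>w\<^sup>p\<^sup>+\<^sup>1 \<ge> (C \<delta>(x))\<^sup>p\<^sup>+\<^sup>1 (T - t)\<close>; before \<open>T / 2\<close> the function \<open>w\<close> is
  bounded away from zero, by compactness.\<close>

section \<open>Pointwise Laplacian and minimum principle\<close>

text \<open>What the exponents achieve: at a touching point the convex function is replaced by its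
  tangent plane, which is linear in \<open>\<psi>\<close> and \<open>w\<close>, so the Laplacians of
  \<open>u\<close> at the times \<open>t\<close> and \<open>t + h\<close> drop out through the
  equation. Only source terms remain. Convexity of \<open>w powr (- p)\<close> bounds their
  increment below by a slope \<open>q\<close> times the increment of \<open>u\<close>, and the
  tangent plane contributes exactly \<open>q\<close> times the comparison function, so the
  difference obeys a linear inequality. Near the quenching time \<open>q\<close> may blow up, but it
  enters only through an exponential weight in the minimum principle, never through the constants of
  the conclusion.

  The obstacle is that \<open>f\<close> may vanish on most of the domain: at time 0 the inequality
  is available only near a point with \<open>f > 0\<close>. Elsewhere a barrier starts nonpositive,
  where the inequality is mere monotonicity of \<open>u\<close> in time, and needs a positive time
  to build up. This delay can be made as short as desired, so finitely many delays fit before any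
  prescribed time, and barriers restarted a fixed time before each \<open>t\<close> have constants
  independent of \<open>t\<close>.\<close>

definition has_second_deriv :: "(real \<Rightarrow> real) \<Rightarrow> real \<Rightarrow> bool" where
  "has_second_deriv F d \<longleftrightarrow> (\<exists>F'. (\<forall>\<^sub>F s in nhds 0. (F has_real_derivative F' s) (at s)) \<and>
     (F' has_real_derivative d) (at 0))"

text \<open>The relational form carries existence together with the value, whereas
  \<open>laplacian\<close> goes through \<open>deriv\<close>, which says nothing where a derivative
  is missing.\<close>

definition has_laplacian :: "('a::euclidean_space \<Rightarrow> real) \<Rightarrow> 'a \<Rightarrow> real \<Rightarrow> bool" where
  "has_laplacian g x l \<longleftrightarrow> (\<exists>d. (\<forall>b\<in>Basis. has_second_deriv (\<lambda>s. g (x + s *\<^sub>R b)) (d b)) \<and>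
     l = (\<Sum>b\<in>Basis. d b))"

lemma has_second_deriv_diff:
  assumes "has_second_deriv F d" "has_second_deriv G e"
  shows "has_second_deriv (\<lambda>s. F s - G s) (d - e)"
proof -
  obtain F' G' where *: "\<forall>\<^sub>F s in nhds 0. (F has_real_derivative F' s) (at s)"
    "(F' has_real_derivative d) (at 0)" "\<forall>\<^sub>F s in nhds 0. (G has_real_derivative G' s) (at s)"
    "(G' has_real_derivative e) (at 0)"
    using assms unfolding has_second_deriv_def by blast
  have "\<forall>\<^sub>F s in nhds 0. ((\<lambda>s. F s - G s) has_real_derivative (F' s - G' s)) (at s)"
    using *(1,3) by eventually_elim (rule DERIV_diff)
  moreover have "((\<lambda>s. F' s - G' s) has_real_derivative (d - e)) (at 0)"
    using *(2,4) by (rule DERIV_diff)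
  ultimately show ?thesis
    unfolding has_second_deriv_def by (intro exI[of _ "\<lambda>s. F' s - G' s"]) simp
qed

lemma has_second_deriv_cmult:
  assumes "has_second_deriv F d"
  shows "has_second_deriv (\<lambda>s. c * F s) (c * d)"
proof -
  obtain F' where *: "\<forall>\<^sub>F s in nhds 0. (F has_real_derivative F' s) (at s)"
    "(F' has_real_derivative d) (at 0)"
    using assms unfolding has_second_deriv_def by blast
  have "\<forall>\<^sub>F s in nhds 0. ((\<lambda>s. c * F s) has_real_derivative (c * F' s)) (at s)"
    using *(1) by eventually_elim (rule DERIV_cmult)
  moreover have "((\<lambda>s. c * F' s) has_real_derivative (c * d)) (at 0)"
    using *(2) by (rule DERIV_cmult)
  ultimately show ?thesis
    unfolding has_second_deriv_def by (intro exI[of _ "\<lambda>s. c * F' s"]) simp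
qed

lemma has_second_deriv_const: "has_second_deriv (\<lambda>s. c) 0"
  unfolding has_second_deriv_def by (intro exI[of _ "\<lambda>s. 0"]) simp

lemma second_deriv_nonneg:
  assumes "has_second_deriv F d" and min: "\<forall>\<^sub>F s in nhds 0. F 0 \<le> F s"
  shows "0 \<le> d"
proof (rule ccontr)
  assume "\<not> 0 \<le> d"
  obtain F' where F': "\<forall>\<^sub>F s in nhds 0. (F has_real_derivative F' s) (at s)"
    and d: "(F' has_real_derivative d) (at 0)"
    using assms(1) unfolding has_second_deriv_def by blast
  obtain e where e: "0 < e" "\<And>s. \<bar>s\<bar> < e \<Longrightarrow> (F has_real_derivative F' s) (at s) \<and> F 0 \<le> F s"
    using eventually_conj[OF F' min] unfolding eventually_nhds_metric by (auto simp: dist_real_def)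
  have "F' 0 = 0"
    by (rule DERIV_local_min[of F _ 0 e]) (use e in auto)
  moreover obtain e' where e': "0 < e'" "\<And>s. 0 < s \<Longrightarrow> s < e' \<Longrightarrow> F' s < F' 0"
    using DERIV_neg_dec_right[OF d] \<open>\<not> 0 \<le> d\<close> by auto
  moreover define s where "s = min e e' / 2"
  moreover have s: "0 < s" "s < e" "s < e'"
    using e e' by (auto simp: s_def)
  moreover obtain z where "0 < z" "z < s" "F s - F 0 = (s - 0) * F' z"
    using MVT2[of 0 s F F'] e(2) s by force
  ultimately have "F s - F 0 < 0"
    by (smt (verit) mult_pos_neg)
  with e(2)[of s] s show False by auto
qed

lemma has_laplacian_diff:
  assumes "has_laplacian g x l" "has_laplacian k x m"
  shows "has_laplacian (\<lambda>y. g y - k y) x (l - m)"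
proof -
  obtain d e where "\<forall>b\<in>Basis. has_second_deriv (\<lambda>s. g (x + s *\<^sub>R b)) (d b)" "l = (\<Sum>b\<in>Basis. d b)"
    "\<forall>b\<in>Basis. has_second_deriv (\<lambda>s. k (x + s *\<^sub>R b)) (e b)" "m = (\<Sum>b\<in>Basis. e b)"
    using assms unfolding has_laplacian_def by blast
  then show ?thesis
    unfolding has_laplacian_def
    by (intro exI[of _ "\<lambda>b. d b - e b"]) (auto simp: sum_subtractf intro: has_second_deriv_diff)
qed

lemma has_laplacian_cmult:
  assumes "has_laplacian g x l"
  shows "has_laplacian (\<lambda>y. c * g y) x (c * l)"
proof -
  obtain d where "\<forall>b\<in>Basis. has_second_deriv (\<lambda>s. g (x + s *\<^sub>R b)) (d b)" "l = (\<Sum>b\<in>Basis. d b)"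
    using assms unfolding has_laplacian_def by blast
  then show ?thesis
    unfolding has_laplacian_def
    by (intro exI[of _ "\<lambda>b. c * d b"]) (auto simp: sum_distrib_left intro: has_second_deriv_cmult)
qed

lemma has_laplacian_const: "has_laplacian (\<lambda>y. c) x 0"
  unfolding has_laplacian_def by (intro exI[of _ "\<lambda>b. 0"]) (simp add: has_second_deriv_const)

text \<open>Along a coordinate line the squared norm is a quadratic polynomial in the parameter, so
  the chain rule applies twice, at the centre \<open>y\<close> too. All explicit barriers below have
  this form in \<open>x\<close>.\<close>

lemma has_laplacian_radial:
  fixes x y :: "'a::euclidean_space"
  assumes q: "\<And>a. (q has_real_derivative q' a) (at a)"
    and q': "\<And>a. (q' has_real_derivative q'' a) (at a)"
  shows "has_laplacian (\<lambda>x. q ((norm (x - y))\<^sup>2)) x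
    (4 * q'' ((norm (x - y))\<^sup>2) * (norm (x - y))\<^sup>2 + 2 * real DIM('a) * q' ((norm (x - y))\<^sup>2))"
proof -
  let ?N = "(norm (x - y))\<^sup>2"
  define d where "d b = 4 * q'' ?N * ((x - y) \<bullet> b)\<^sup>2 + 2 * q' ?N" for b
  have "has_second_deriv (\<lambda>s. q ((norm (x + s *\<^sub>R b - y))\<^sup>2)) (d b)" if b: "b \<in> Basis" for b
  proof -
    let ?B = "(x - y) \<bullet> b"
    have N: "(norm (x + s *\<^sub>R b - y))\<^sup>2 = ?N + 2 * s * ?B + s\<^sup>2" for s
    proof -
      have "x + s *\<^sub>R b - y = (x - y) + s *\<^sub>R b" by simp
      then have "(norm (x + s *\<^sub>R b - y))\<^sup>2 = ((x - y) + s *\<^sub>R b) \<bullet> ((x - y) + s *\<^sub>R b)"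
        by (simp only: power2_norm_eq_inner)
      also have "\<dots> = ?N + 2 * s * ?B + s\<^sup>2"
        using b unfolding inner_add_left inner_add_right
        by (simp add: dot_square_norm inner_commute power2_eq_square)
      finally show ?thesis .
    qed
    define Q where "Q s = q' (?N + 2 * s * ?B + s\<^sup>2) * (2 * ?B + 2 * s)" for s
    have 1: "((\<lambda>s. q (?N + 2 * s * ?B + s\<^sup>2)) has_real_derivative Q s) (at s)" for s
      unfolding Q_def
      by (rule DERIV_chain2[OF q]) (auto intro!: derivative_eq_intros)
    have "(Q has_real_derivative
      (q'' (?N + 2 * 0 * ?B + 0\<^sup>2) * (2 * ?B + 2 * 0)) * (2 * ?B + 2 * 0) + 2 * q' (?N + 2 * 0 * ?B + 0\<^sup>2)) (at 0)"
      unfolding Q_def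
      by (rule DERIV_mult DERIV_chain2[OF q'])+ (auto intro!: derivative_eq_intros)
    then have 2: "(Q has_real_derivative d b) (at 0)"
      by (simp add: d_def power2_eq_square mult_ac)
    show ?thesis
      unfolding N has_second_deriv_def using 1 2 by (intro exI[of _ Q]) simp
  qed
  moreover have "(\<Sum>b\<in>Basis. ((x - y) \<bullet> b)\<^sup>2) = (x - y) \<bullet> (x - y)"
    unfolding euclidean_inner[of "x - y" "x - y"] by (simp only: power2_eq_square)
  then have "4 * q'' ?N * ?N + 2 * real DIM('a) * q' ?N = (\<Sum>b\<in>Basis. d b)"
    unfolding d_def sum.distrib by (simp add: sum_distrib_left [symmetric] dot_square_norm)
  ultimately show ?thesis
    unfolding has_laplacian_def by (intro exI[of _ d]) simp
qed

text \<open>A negative value forces a negative minimum of \<open>exp (- K * t) * J x t\<close> on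
  the compact cylinder, away from the parabolic boundary; refuting it is left to the caller through
  \<open>no_min\<close>. The weight absorbs a zeroth-order term with coefficient below
  \<open>K\<close>.\<close>

lemma minimum_principle:
  fixes J :: "'a::euclidean_space \<Rightarrow> real \<Rightarrow> real"
  assumes "bounded B" and "open B"
    and cont: "continuous_on (closure B \<times> {s..\<tau>}) (\<lambda>(x, t). J x t)"
    and init: "\<And>x. x \<in> closure B \<Longrightarrow> 0 \<le> J x s"
    and bdry: "\<And>x t. x \<in> frontier B \<Longrightarrow> s \<le> t \<Longrightarrow> t \<le> \<tau> \<Longrightarrow> 0 \<le> J x t"
    and no_min: "\<And>x0 t0. x0 \<in> B \<Longrightarrow> s < t0 \<Longrightarrow> t0 \<le> \<tau> \<Longrightarrow> J x0 t0 < 0 \<Longrightarrow>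
      (\<And>x t. x \<in> closure B \<Longrightarrow> s \<le> t \<Longrightarrow> t \<le> \<tau> \<Longrightarrow>
         exp (- K * t0) * J x0 t0 \<le> exp (- K * t) * J x t) \<Longrightarrow> False"
    and x: "x \<in> closure B" and t: "s \<le> t" "t \<le> \<tau>"
  shows "0 \<le> J x t"
proof (rule ccontr)
  assume neg: "\<not> 0 \<le> J x t"
  have "compact (closure B \<times> {s..\<tau>})"
    using \<open>bounded B\<close> by (intro compact_Times) (auto simp: compact_closure)
  moreover have "closure B \<times> {s..\<tau>} \<noteq> {}"
    using x t by auto
  moreover have "continuous_on (closure B \<times> {s..\<tau>}) (\<lambda>z. exp (- K * snd z) * J (fst z) (snd z))"
    using cont by (intro continuous_intros) (auto simp: case_prod_unfold)
  ultimately obtain z where z: "z \<in> closure B \<times> {s..\<tau>}"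
    "\<And>z'. z' \<in> closure B \<times> {s..\<tau>} \<Longrightarrow>
      exp (- K * snd z) * J (fst z) (snd z) \<le> exp (- K * snd z') * J (fst z') (snd z')"
    using continuous_attains_inf[of "closure B \<times> {s..\<tau>}" "\<lambda>z. exp (- K * snd z) * J (fst z) (snd z)"]
    by blast
  obtain x0 t0 where [simp]: "z = (x0, t0)" by (cases z)
  have mn: "exp (- K * t0) * J x0 t0 \<le> exp (- K * t) * J x t"
    if "x \<in> closure B" "s \<le> t" "t \<le> \<tau>" for x t
    using z(2)[of "(x, t)"] that by auto
  from mn[OF x t] have "exp (- K * t0) * J x0 t0 < 0"
    using neg by (smt (verit) exp_gt_zero mult_pos_neg)
  then have J0: "J x0 t0 < 0"
    by (simp add: mult_less_0_iff)
  have t0: "s \<le> t0" "t0 \<le> \<tau>" "x0 \<in> closure B"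
    using z(1) by auto
  then have "t0 \<noteq> s" "x0 \<notin> frontier B"
    using J0 init[of x0] bdry[of x0 t0] by auto
  then have "x0 \<in> B" "s < t0"
    using t0 \<open>open B\<close> by (auto simp: frontier_def interior_open)
  then show False
    using no_min[OF _ _ t0(2) J0 mn] by blast
qed

text \<open>The second derivative test makes the Laplacian nonnegative. Only times up to
  \<open>t0\<close> are compared, since \<open>t0\<close> may be the final time, so the time
  derivative of the weighted function is merely nonpositive; this gives
  \<open>a \<le> K * L x0 t0\<close>.\<close>

lemma spacetime_minimum:
  fixes L :: "'a::euclidean_space \<Rightarrow> real \<Rightarrow> real"
  assumes "open B" "x0 \<in> B" "s < t0"
    and mn: "\<And>x t. x \<in> B \<Longrightarrow> s < t \<Longrightarrow> t \<le> t0 \<Longrightarrow>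
      exp (- K * t0) * L x0 t0 \<le> exp (- K * t) * L x t"
    and a: "(L x0 has_real_derivative a) (at t0)"
    and l: "has_laplacian (\<lambda>y. L y t0) x0 l"
  shows "a - l \<le> K * L x0 t0"
proof -
  have "0 \<le> l"
  proof -
    obtain d where d: "\<And>b. b \<in> Basis \<Longrightarrow> has_second_deriv (\<lambda>s. L (x0 + s *\<^sub>R b) t0) (d b)"
      "l = (\<Sum>b\<in>Basis. d b)"
      using l unfolding has_laplacian_def by blast
    have "0 \<le> d b" if "b \<in> Basis" for b
    proof (rule second_deriv_nonneg[OF d(1)[OF that]])
      have "((\<lambda>s. x0 + s *\<^sub>R b) \<longlongrightarrow> x0 + 0 *\<^sub>R b) (nhds 0)"
        by (intro tendsto_intros filterlim_ident)
      then have "\<forall>\<^sub>F s in nhds 0. x0 + s *\<^sub>R b \<in> B"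
        using assms(1,2) by (intro topological_tendstoD[where l = x0]) auto
      then show "\<forall>\<^sub>F s in nhds 0. L (x0 + 0 *\<^sub>R b) t0 \<le> L (x0 + s *\<^sub>R b) t0"
        by eventually_elim (use mn[of _ t0] \<open>s < t0\<close> in auto)
    qed
    then show ?thesis
      using d(2) by (simp add: sum_nonneg)
  qed
  moreover have "a \<le> K * L x0 t0"
  proof (rule ccontr)
    assume "\<not> a \<le> K * L x0 t0"
    then have "0 < exp (- K * t0) * (a - K * L x0 t0)" by simp
    moreover have "((\<lambda>t. exp (- K * t) * L x0 t) has_real_derivative
      exp (- K * t0) * (a - K * L x0 t0)) (at t0)"
      by (rule derivative_eq_intros a refl)+ (auto simp: algebra_simps)
    ultimately obtain e where e: "0 < e"
      "\<And>h. 0 < h \<Longrightarrow> h < e \<Longrightarrow> exp (- K * (t0 - h)) * L x0 (t0 - h) < exp (- K * t0) * L x0 t0"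
      using DERIV_pos_inc_left by blast
    define h where "h = min e (t0 - s) / 2"
    have "0 < h" "h < e" "s < t0 - h"
      using e(1) \<open>s < t0\<close> by (auto simp: h_def field_simps min_def)
    then show False
      using e(2)[of h] mn[of x0 "t0 - h"] assms(2) by force
  qed
  ultimately show ?thesis by simp
qed

section \<open>Convexity inequalities behind the comparison function\<close>

text \<open>Tangent line of \<open>w powr (- p)\<close>: for \<open>z = w' / w\<close>, the bounds
  \<open>ln z \<le> z - 1\<close> and \<open>1 + y \<le> exp y\<close> give
  \<open>1 + p * (1 - z) \<le> z powr (- p)\<close>.\<close>

lemma convex_powr_neg:
  fixes p w w' :: real
  assumes "0 < p" "0 < w" "0 < w'"
  shows "p * w powr (- p - 1) * (w - w') \<le> w' powr (- p) - w powr (- p)"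
proof -
  let ?z = "w' / w"
  have "ln ?z \<le> ?z - 1"
    using assms by (intro ln_le_minus_one) auto
  then have "1 + p * (1 - ?z) \<le> 1 - p * ln ?z"
    using mult_left_mono[of "ln ?z" "?z - 1" p] \<open>0 < p\<close> by (simp add: algebra_simps)
  also have "\<dots> \<le> exp (- p * ln ?z)"
    using exp_ge_add_one_self[of "- p * ln ?z"] by simp
  also have "\<dots> = ?z powr (- p)"
    using assms by (simp add: powr_def)
  finally have "w powr (- p) * (1 + p * (1 - ?z)) \<le> w powr (- p) * ?z powr (- p)"
    by (intro mult_left_mono) auto
  also have "\<dots> = w' powr (- p)"
    using assms by (subst powr_mult[symmetric]) auto
  finally have "w powr (- p) * (1 + p * (1 - ?z)) \<le> w' powr (- p)" .
  moreover have "w powr (- p) = w powr (- p - 1) * w"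
    using assms by (simp add: powr_diff)
  then have "p * w powr (- p - 1) * (w - w') = w powr (- p) * (p * (1 - ?z))"
    using assms by (simp add: field_simps)
  ultimately show ?thesis
    by (simp add: algebra_simps)
qed

text \<open>Tangent planes of \<open>a powr (p + 1) * w powr (- p)\<close>, indexed by the ratio
  \<open>l = a / w\<close> at which they touch. The weights \<open>1 / (p + 1)\<close> and
  \<open>p / (p + 1)\<close> in the weighted mean of \<open>X\<close> and \<open>Y\<close> cancel
  the powers of \<open>w\<close>.\<close>

lemma young_powr:
  fixes p w l a :: real
  assumes "0 < p" "0 < w" "0 \<le> l" "0 \<le> a"
  shows "(p + 1) * l powr p * a - p * l powr (p + 1) * w \<le> a powr (p + 1) * w powr (- p)"
proof (cases "l = 0 \<or> a = 0")
  case True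
  then show ?thesis using assms by auto
next
  case False
  then have "0 < l" "0 < a" using assms by auto
  define X where "X = a powr (p + 1) * w powr (- p)"
  define Y where "Y = l powr (p + 1) * w"
  have "X powr (1 / (p + 1)) * Y powr (p / (p + 1)) \<le> 1 / (p + 1) * X + p / (p + 1) * Y"
    by (rule Youngs_inequality_0) (use assms \<open>0 < l\<close> \<open>0 < a\<close> in \<open>auto simp: X_def Y_def field_simps\<close>)
  also have "X powr (1 / (p + 1)) * Y powr (p / (p + 1)) = a * l powr p"
  proof -
    have "X powr (1 / (p + 1)) = a * w powr (- p / (p + 1))"
      using assms by (simp add: X_def powr_mult powr_powr)
    moreover have "Y powr (p / (p + 1)) = l powr p * w powr (p / (p + 1))"
      using assms by (simp add: Y_def powr_mult powr_powr)
    moreover have "w powr (- p / (p + 1)) * w powr (p / (p + 1)) = 1"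
      using assms by (simp flip: powr_add)
    ultimately show ?thesis by (simp add: mult_ac)
  qed
  finally have "(p + 1) * (a * l powr p) \<le> (p + 1) * (1 / (p + 1) * X + p / (p + 1) * Y)"
    using assms by (intro mult_left_mono) auto
  also have "\<dots> = X + p * Y"
    using \<open>0 < p\<close> by (simp add: distrib_left)
  finally show ?thesis
    by (simp add: X_def Y_def algebra_simps)
qed

lemma has_partial_deriv:
  assumes "partial_differentiable b g (x + s *\<^sub>R b)"
  shows "((\<lambda>s. g (x + s *\<^sub>R b)) has_real_derivative partial_deriv b g (x + s *\<^sub>R b)) (at s)"
proof -
  have "((\<lambda>r. g (x + s *\<^sub>R b + r *\<^sub>R b)) has_real_derivative partial_deriv b g (x + s *\<^sub>R b)) (at 0)"
    using assms unfolding partial_differentiable_def partial_deriv_def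
    by (rule field_differentiable_derivI)
  moreover have "x + s *\<^sub>R b + r *\<^sub>R b = x + (r + s) *\<^sub>R b" for r
    by (simp add: scaleR_add_left)
  ultimately show ?thesis
    using DERIV_shift[of "\<lambda>s. g (x + s *\<^sub>R b)" _ 0 s] by simp
qed

lemma has_laplacian_laplacian:
  assumes "open S" "x \<in> S"
    and "\<And>b y. b \<in> Basis \<Longrightarrow> y \<in> S \<Longrightarrow> partial_differentiable b g y"
    and "\<And>b. b \<in> Basis \<Longrightarrow> partial_differentiable b (partial_deriv b g) x"
  shows "has_laplacian g x (laplacian g x)"
  unfolding has_laplacian_def laplacian_def
proof (intro exI[of _ "\<lambda>b. partial_deriv b (partial_deriv b g) x"] conjI ballI)
  fix b :: 'a assume b: "b \<in> Basis"
  have "((\<lambda>s. x + s *\<^sub>R b) \<longlongrightarrow> x + 0 *\<^sub>R b) (nhds 0)"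
    by (intro tendsto_intros filterlim_ident)
  then have "\<forall>\<^sub>F s in nhds 0. x + s *\<^sub>R b \<in> S"
    using assms(1,2) by (intro topological_tendstoD[where l = x]) auto
  then have "\<forall>\<^sub>F s in nhds 0. ((\<lambda>s. g (x + s *\<^sub>R b)) has_real_derivative partial_deriv b g (x + s *\<^sub>R b)) (at s)"
    by eventually_elim (use assms(3)[OF b] in \<open>rule has_partial_deriv\<close>)
  moreover have "((\<lambda>s. partial_deriv b g (x + s *\<^sub>R b)) has_real_derivative
      partial_deriv b (partial_deriv b g) x) (at 0)"
    using has_partial_deriv[of b "partial_deriv b g" x 0] assms(4)[OF b] by simp
  ultimately show "has_second_deriv (\<lambda>s. g (x + s *\<^sub>R b)) (partial_deriv b (partial_deriv b g) x)"
    unfolding has_second_deriv_def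
    by (intro exI[of _ "\<lambda>s. partial_deriv b g (x + s *\<^sub>R b)"] conjI)
qed (rule refl)

section \<open>Interior balls at a \<open>C\<^sup>2\<^sup>+\<^sup>\<nu>\<close> boundary\<close>

text \<open>Changes one coordinate at a time; all intermediate points stay within distance
  \<open>norm v\<close> of \<open>a\<close>.\<close>

lemma partial_deriv_increment:
  fixes g :: "'a::euclidean_space \<Rightarrow> real"
  assumes diff: "\<And>b x. b \<in> Basis \<Longrightarrow> norm (x - a) \<le> norm v \<Longrightarrow> partial_differentiable b g x"
    and close: "\<And>b x. b \<in> Basis \<Longrightarrow> norm (x - a) \<le> norm v \<Longrightarrow> \<bar>partial_deriv b g x - c b\<bar> \<le> \<epsilon>"
  shows "\<bar>g (a + v) - g a - (\<Sum>b\<in>Basis. c b * (v \<bullet> b))\<bar> \<le> real DIM('a) * (\<epsilon> * norm v)"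
proof -
  \<comment> \<open>\<open>V A\<close> keeps the coordinates of \<open>v\<close> in \<open>A\<close>
    and zeroes the others; inserting one index moves the point along one coordinate line.\<close>
  define V where "V A = (\<Sum>i\<in>Basis. (if i \<in> A then v \<bullet> i else 0) *\<^sub>R i)" for A
  have V: "V A \<bullet> i = (if i \<in> A then v \<bullet> i else 0)" if "i \<in> Basis" for A i
    using that by (simp add: V_def)
  have "\<bar>g (a + V A) - g a - (\<Sum>b\<in>A. c b * (v \<bullet> b))\<bar> \<le> real (card A) * (\<epsilon> * norm v)"
    if "finite A" "A \<subseteq> Basis" for A
    using that
  proof (induction A rule: finite_induct)
    case empty
    then show ?case by (simp add: V_def)
  next
    case (insert b A)
    then have b: "b \<in> Basis" by simp
    let ?w = "v \<bullet> b"
    have V_insert: "V (insert b A) = V A + ?w *\<^sub>R b"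
    proof (rule euclidean_eqI)
      fix i :: 'a assume "i \<in> Basis"
      then show "V (insert b A) \<bullet> i = (V A + ?w *\<^sub>R b) \<bullet> i"
        using V b insert.hyps by (auto simp: inner_add_left inner_Basis)
    qed
    have near: "norm (a + V A + (r * ?w) *\<^sub>R b - a) \<le> norm v" if r: "0 \<le> r" "r \<le> 1" for r
    proof (rule norm_le_componentwise)
      fix i :: 'a assume i: "i \<in> Basis"
      have "\<bar>r * ?w\<bar> \<le> \<bar>?w\<bar>"
        using r by (simp add: abs_mult mult_left_le_one_le)
      then show "\<bar>(a + V A + (r * ?w) *\<^sub>R b - a) \<bullet> i\<bar> \<le> \<bar>v \<bullet> i\<bar>"
        using V[OF i] b i insert.hyps by (auto simp: inner_add_left inner_Basis)
    qed
    define F where "F r = g (a + V A + (r * ?w) *\<^sub>R b)" for r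
    have "(F has_real_derivative partial_deriv b g (a + V A + (r * ?w) *\<^sub>R b) * ?w) (at r)"
      if "0 \<le> r" "r \<le> 1" for r
      unfolding F_def
      by (rule DERIV_chain2[where f = "\<lambda>s. g (a + V A + s *\<^sub>R b)" and g = "\<lambda>r. r * ?w",
        OF has_partial_deriv[OF diff[OF b near[OF that]]]])
        (auto intro!: derivative_eq_intros)
    then obtain z where z: "0 < z" "z < 1"
      "F 1 - F 0 = (1 - 0) * (partial_deriv b g (a + V A + (z * ?w) *\<^sub>R b) * ?w)"
      using MVT2[of 0 1 F "\<lambda>r. partial_deriv b g (a + V A + (r * ?w) *\<^sub>R b) * ?w"] by auto
    define P where "P = partial_deriv b g (a + V A + (z * ?w) *\<^sub>R b)"
    have P: "\<bar>P - c b\<bar> \<le> \<epsilon>"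
      unfolding P_def by (rule close[OF b near]) (use z in auto)
    have "\<bar>(P - c b) * ?w\<bar> \<le> \<epsilon> * norm v"
      unfolding abs_mult using P Basis_le_norm[OF b, of v] by (intro mult_mono) auto
    moreover have "g (a + V (insert b A)) - g (a + V A) = P * ?w"
      using z(3) by (simp add: F_def P_def V_insert add.assoc)
    ultimately have "\<bar>g (a + V (insert b A)) - g (a + V A) - c b * ?w\<bar> \<le> \<epsilon> * norm v"
      by (simp add: left_diff_distrib)
    moreover have "\<bar>g (a + V A) - g a - (\<Sum>b\<in>A. c b * (v \<bullet> b))\<bar> \<le> real (card A) * (\<epsilon> * norm v)"
      using insert by auto
    ultimately show ?case
      using insert.hyps by (simp add: distrib_right)
  qed
  from this[of Basis] show ?thesis
    by (simp add: V_def euclidean_representation)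
qed

text \<open>The Hoelder condition bounds the second derivatives on the ball by comparison with the
  centre. Then \<open>partial_deriv_increment\<close> serves three times: for the first derivatives
  with \<open>c\<close> zero (Lipschitz gradient), for \<open>\<phi>\<close> with \<open>c\<close>
  zero, and for \<open>\<phi>\<close> with \<open>c\<close> the gradient at \<open>a\<close>
  (quadratic Taylor remainder).\<close>

lemma C2_holder_on_ball_bounds:
  fixes z :: "'a::euclidean_space"
  assumes C2: "C2_holder_on \<nu> (ball z r) \<phi>" and "0 < \<nu>" "0 < r"
  obtains G M where "0 \<le> G" "0 \<le> M"
    "\<And>x b. x \<in> ball z r \<Longrightarrow> b \<in> Basis \<Longrightarrow> \<bar>partial_deriv b \<phi> x\<bar> \<le> G"
    "\<And>a v. cball a (norm v) \<subseteq> ball z r \<Longrightarrow> \<bar>\<phi> (a + v) - \<phi> a\<bar> \<le> real DIM('a) * (G * norm v)"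
    "\<And>a v. cball a (norm v) \<subseteq> ball z r \<Longrightarrow>
      \<bar>\<phi> (a + v) - \<phi> a - (\<Sum>b\<in>Basis. partial_deriv b \<phi> a * (v \<bullet> b))\<bar> \<le> M * (norm v)\<^sup>2"
proof -
  let ?n = "real DIM('a)"
  let ?H = "\<lambda>i j. partial_deriv j (partial_deriv i \<phi>)"
  have d1: "partial_differentiable i \<phi> x"
    and d2: "partial_differentiable j (partial_deriv i \<phi>) x"
    if "i \<in> Basis" "j \<in> Basis" "x \<in> ball z r" for i j x
    using C2 that unfolding C2_holder_on_def by auto
  have "\<exists>C. \<forall>x\<in>ball z r. \<bar>?H i j x\<bar> \<le> C" if "i \<in> Basis" "j \<in> Basis" for i j
  proof -
    have "holder_on \<nu> (ball z r) (?H i j)"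
      using C2 that unfolding C2_holder_on_def by blast
    then obtain C where C: "\<And>x y. x \<in> ball z r \<Longrightarrow> y \<in> ball z r \<Longrightarrow>
        \<bar>?H i j x - ?H i j y\<bar> \<le> C * dist x y powr \<nu>"
      unfolding holder_on_def by blast
    have "\<bar>?H i j x\<bar> \<le> \<bar>?H i j z\<bar> + \<bar>C\<bar> * r powr \<nu>" if x: "x \<in> ball z r" for x
    proof -
      have "\<bar>?H i j x - ?H i j z\<bar> \<le> C * dist x z powr \<nu>"
        by (rule C) (use x \<open>0 < r\<close> in auto)
      also have "\<dots> \<le> \<bar>C\<bar> * r powr \<nu>"
        using x assms by (intro mult_mono powr_mono2) (auto simp: dist_commute)
      finally show ?thesis by linarith
    qed
    then show ?thesis by blast
  qed
  then obtain C where C: "\<And>i j x. i \<in> Basis \<Longrightarrow> j \<in> Basis \<Longrightarrow> x \<in> ball z r \<Longrightarrow> \<bar>?H i j x\<bar> \<le> C i j"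
    by metis
  define M2 where "M2 = (\<Sum>i\<in>Basis. \<Sum>j\<in>Basis. \<bar>C i j\<bar>)"
  have M2: "0 \<le> M2" by (auto simp: M2_def intro!: sum_nonneg)
  have H: "\<bar>?H i j x\<bar> \<le> M2" if ij: "i \<in> Basis" "j \<in> Basis" and x: "x \<in> ball z r" for i j x
  proof -
    have "\<bar>?H i j x\<bar> \<le> \<bar>C i j\<bar>" using C[OF ij x] by linarith
    also have "\<dots> \<le> (\<Sum>j\<in>Basis. \<bar>C i j\<bar>)"
      using ij by (intro member_le_sum) auto
    also have "\<dots> \<le> M2"
      unfolding M2_def using ij by (intro member_le_sum[of i]) (auto intro: sum_nonneg)
    finally show ?thesis .
  qed
  have lip: "\<bar>partial_deriv i \<phi> (a + v) - partial_deriv i \<phi> a\<bar> \<le> ?n * (M2 * norm v)"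
    if i: "i \<in> Basis" and sub: "cball a (norm v) \<subseteq> ball z r" for i a v
  proof -
    have in_ball: "x \<in> ball z r" if "norm (x - a) \<le> norm v" for x
      using sub that by (metis dist_norm dist_commute mem_cball subsetD)
    have "\<bar>partial_deriv i \<phi> (a + v) - partial_deriv i \<phi> a - (\<Sum>b\<in>Basis. 0 * (v \<bullet> b))\<bar>
        \<le> ?n * (M2 * norm v)"
      by (rule partial_deriv_increment) (use in_ball d2 H i in auto)
    then show ?thesis by simp
  qed
  define G where "G = (\<Sum>i\<in>Basis. \<bar>partial_deriv i \<phi> z\<bar>) + ?n * (M2 * r)"
  have G: "0 \<le> G" using M2 \<open>0 < r\<close> by (auto simp: G_def intro!: add_nonneg_nonneg sum_nonneg)
  have grad: "\<bar>partial_deriv b \<phi> x\<bar> \<le> G" if x: "x \<in> ball z r" and b: "b \<in> Basis" for x b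
  proof -
    have nx: "norm (x - z) < r" using x by (simp add: dist_norm norm_minus_commute)
    then have "cball z (norm (x - z)) \<subseteq> ball z r" by auto
    from lip[OF b this] have "\<bar>partial_deriv b \<phi> x - partial_deriv b \<phi> z\<bar> \<le> ?n * (M2 * norm (x - z))"
      by simp
    also have "\<dots> \<le> ?n * (M2 * r)" using M2 nx by (intro mult_left_mono) auto
    finally have "\<bar>partial_deriv b \<phi> x\<bar> \<le> \<bar>partial_deriv b \<phi> z\<bar> + ?n * (M2 * r)" by linarith
    moreover have "\<bar>partial_deriv b \<phi> z\<bar> \<le> (\<Sum>i\<in>Basis. \<bar>partial_deriv i \<phi> z\<bar>)"
      using b by (intro member_le_sum[of b Basis "\<lambda>i. \<bar>partial_deriv i \<phi> z\<bar>"]) auto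
    ultimately show ?thesis by (simp add: G_def)
  qed
  show thesis
  proof (rule that[OF G _ grad, of "?n * (?n * M2)"])
    show "0 \<le> ?n * (?n * M2)" using M2 by simp
  next
    fix a v :: 'a assume sub: "cball a (norm v) \<subseteq> ball z r"
    have in_ball: "x \<in> ball z r" if "norm (x - a) \<le> norm v" for x
      using sub that by (metis dist_norm dist_commute mem_cball subsetD)
    have "\<bar>\<phi> (a + v) - \<phi> a - (\<Sum>b\<in>Basis. 0 * (v \<bullet> b))\<bar> \<le> ?n * (G * norm v)"
      by (rule partial_deriv_increment) (use in_ball d1 grad in auto)
    then show "\<bar>\<phi> (a + v) - \<phi> a\<bar> \<le> ?n * (G * norm v)" by simp
    have "\<bar>\<phi> (a + v) - \<phi> a - (\<Sum>b\<in>Basis. partial_deriv b \<phi> a * (v \<bullet> b))\<bar>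
        \<le> ?n * ((?n * (M2 * norm v)) * norm v)"
    proof (rule partial_deriv_increment)
      fix b x :: 'a assume b: "b \<in> Basis" and x: "norm (x - a) \<le> norm v"
      show "partial_differentiable b \<phi> x" using in_ball[OF x] d1 b by blast
      have "cball a (norm (x - a)) \<subseteq> ball z r" using sub x by (meson order_trans subset_cball)
      from lip[OF b this] have "\<bar>partial_deriv b \<phi> x - partial_deriv b \<phi> a\<bar> \<le> ?n * (M2 * norm (x - a))"
        by simp
      also have "\<dots> \<le> ?n * (M2 * norm v)" using M2 x by (intro mult_left_mono) auto
      finally show "\<bar>partial_deriv b \<phi> x - partial_deriv b \<phi> a\<bar> \<le> ?n * (M2 * norm v)" .
    qed
    then show "\<bar>\<phi> (a + v) - \<phi> a - (\<Sum>b\<in>Basis. partial_deriv b \<phi> a * (v \<bullet> b))\<bar>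
        \<le> ?n * (?n * M2) * (norm v)\<^sup>2"
      by (simp add: power2_eq_square mult_ac)
  qed auto
qed

text \<open>From \<open>x\<close> one descends along \<open>e\<close> to the point \<open>a\<close>
  of the graph and takes the ball touching the graph at \<open>a\<close> from above. The Taylor
  bound keeps it above the graph, with a radius \<open>R\<close> depending on \<open>z\<close> only.
  The height \<open>d\<close> of \<open>x\<close> over \<open>a\<close> dominates the distance to
  the frontier and is at most a multiple of \<open>R - dist y x\<close>.\<close>

lemma C2_holder_boundary_interior_ball:
  fixes \<Omega> :: "'a::euclidean_space set"
  assumes "open \<Omega>" "C2_holder_boundary \<nu> \<Omega>" "0 < \<nu>" and z: "z \<in> frontier \<Omega>"
  shows "\<exists>\<rho>>0. \<exists>R>0. \<exists>c>0. \<forall>x\<in>\<Omega> \<inter> ball z \<rho>. \<exists>y. ball y R \<subseteq> \<Omega> \<and> x \<in> ball y R \<and>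
    c * infdist x (frontier \<Omega>) \<le> R - dist y x"
proof -
  obtain r e \<phi> where r: "0 < r" and e: "norm e = 1" and \<phi>_e: "\<And>x s. \<phi> (x + s *\<^sub>R e) = \<phi> x"
    and C2: "C2_holder_on \<nu> (ball z r) \<phi>"
    and \<Omega>: "\<Omega> \<inter> ball z r = {x \<in> ball z r. \<phi> x < x \<bullet> e}"
    using assms unfolding C2_holder_boundary_def by blast
  let ?n = "real DIM('a)"
  obtain G M where GM: "0 \<le> G" "0 \<le> M"
    and grad: "\<And>x b. x \<in> ball z r \<Longrightarrow> b \<in> Basis \<Longrightarrow> \<bar>partial_deriv b \<phi> x\<bar> \<le> G"
    and lip: "\<And>a v. cball a (norm v) \<subseteq> ball z r \<Longrightarrow> \<bar>\<phi> (a + v) - \<phi> a\<bar> \<le> ?n * (G * norm v)"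
    and taylor: "\<And>a v. cball a (norm v) \<subseteq> ball z r \<Longrightarrow>
      \<bar>\<phi> (a + v) - \<phi> a - (\<Sum>b\<in>Basis. partial_deriv b \<phi> a * (v \<bullet> b))\<bar> \<le> M * (norm v)\<^sup>2"
    by (rule C2_holder_on_ball_bounds[OF C2 \<open>0 < \<nu>\<close> r], rule that)
  have mem_iff: "x \<in> \<Omega> \<longleftrightarrow> \<phi> x < x \<bullet> e" if "x \<in> ball z r" for x
    using \<Omega> that by blast
  have z_notin: "z \<notin> \<Omega>" using z \<open>open \<Omega>\<close> by (simp add: frontier_def interior_open)
  have \<phi>z: "\<phi> z = z \<bullet> e"
  proof (rule antisym)
    show "z \<bullet> e \<le> \<phi> z" using mem_iff[of z] z_notin r by simp
    show "\<phi> z \<le> z \<bullet> e"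
    proof (rule ccontr)
      assume "\<not> \<phi> z \<le> z \<bullet> e"
      moreover have "continuous_on (ball z r) \<phi>" using C2 unfolding C2_holder_on_def by blast
      then have "isCont \<phi> z" using r by (simp add: continuous_on_eq_continuous_at)
      then have "((\<lambda>x. \<phi> x - x \<bullet> e) \<longlongrightarrow> \<phi> z - z \<bullet> e) (at z)"
        unfolding isCont_def by (intro tendsto_intros)
      ultimately have "\<forall>\<^sub>F x in at z. 0 < \<phi> x - x \<bullet> e"
        by (intro order_tendstoD(1)) auto
      then obtain d where d: "0 < d" "\<And>x. x \<noteq> z \<Longrightarrow> dist x z < d \<Longrightarrow> x \<bullet> e < \<phi> x"
        unfolding eventually_at by auto
      have "z \<in> closure \<Omega>" using z by (simp add: frontier_def)
      then obtain x where "x \<in> \<Omega>" "dist x z < min d r"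
        using d(1) r unfolding closure_approachable by (metis min_less_iff_conj)
      moreover from this have "x \<noteq> z" using z_notin by auto
      ultimately show False using d(2)[of x] mem_iff[of x] by (simp add: dist_commute)
    qed
  qed
  \<comment> \<open>\<open>K\<close> bounds both the height of \<open>x\<close> relative to
    \<open>norm (x - z)\<close> and the length of the normal \<open>N\<close>.\<close>
  define K where "K = 1 + ?n * G"
  have K: "1 \<le> K" using GM by (simp add: K_def)
  \<comment> \<open>\<open>R \<le> r / 4\<close> keeps the ball, of diameter \<open>2 * R\<close>,
    inside the chart; \<open>2 * R * M \<le> 1\<close> makes its curvature beat the Taylor
    remainder.\<close>
  define R where "R = min (r / 4) (1 / (2 * (M + 1)))"
  have R: "0 < R" "4 * R \<le> r" "2 * R * M \<le> 1"
  proof -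
    show "0 < R" "4 * R \<le> r" using r GM by (auto simp: R_def)
    have "R \<le> 1 / (2 * (M + 1))" by (simp add: R_def)
    then have "2 * R * (M + 1) \<le> 1" using GM by (simp add: field_simps)
    then show "2 * R * M \<le> 1" using \<open>0 < R\<close> by (simp add: distrib_left)
  qed
  \<comment> \<open>The first bound keeps \<open>a\<close> within \<open>r / 2\<close> of
    \<open>z\<close>; the second gives \<open>d \<le> R / K \<le> R / norm N\<close>, which places
    \<open>x\<close> inside the ball.\<close>
  define \<rho> where "\<rho> = min (r / (2 * (1 + K))) (R / (K * K))"
  have \<rho>: "0 < \<rho>" "(1 + K) * \<rho> \<le> r / 2" "K * \<rho> \<le> R / K"
  proof -
    show "0 < \<rho>" using r R K by (simp add: \<rho>_def)
    have "\<rho> \<le> r / (2 * (1 + K))" by (simp add: \<rho>_def)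
    then show "(1 + K) * \<rho> \<le> r / 2" using K by (simp add: field_simps)
    have "\<rho> \<le> R / (K * K)" by (simp add: \<rho>_def)
    then show "K * \<rho> \<le> R / K" using K by (simp add: field_simps)
  qed
  have "\<exists>y. ball y R \<subseteq> \<Omega> \<and> x \<in> ball y R \<and> 1 / (2 * K) * infdist x (frontier \<Omega>) \<le> R - dist y x"
    if x: "x \<in> \<Omega>" "x \<in> ball z \<rho>" for x
  proof -
    have xz: "norm (x - z) < \<rho>" using x by (simp add: dist_norm norm_minus_commute)
    have "2 * \<rho> \<le> (1 + K) * \<rho>" using K \<rho>(1) by (intro mult_right_mono) auto
    then have "\<rho> < r" using \<rho>(2) r by linarith
    then have xr: "x \<in> ball z r" using x by simp
    define d where "d = x \<bullet> e - \<phi> x"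
    have d0: "0 < d" using x mem_iff[OF xr] by (simp add: d_def)
    have "cball z (norm (x - z)) \<subseteq> ball z r" using xz \<open>\<rho> < r\<close> by auto
    from lip[OF this] have "\<bar>\<phi> x - \<phi> z\<bar> \<le> ?n * (G * norm (x - z))" by simp
    moreover have "\<bar>(x - z) \<bullet> e\<bar> \<le> norm (x - z)"
      using Cauchy_Schwarz_ineq2[of "x - z" e] e by simp
    ultimately have "d \<le> K * norm (x - z)"
      using \<phi>z by (simp add: d_def K_def inner_diff_left algebra_simps)
    also have "\<dots> \<le> K * \<rho>" using xz K by (intro mult_left_mono) auto
    finally have dK: "d \<le> K * \<rho>" .
    define a where "a = x - d *\<^sub>R e"
    have \<phi>a: "\<phi> a = a \<bullet> e"
    proof -
      have "a = x + (- d) *\<^sub>R e" by (simp add: a_def)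
      then have "\<phi> a = \<phi> x" by (simp only: \<phi>_e)
      also have "\<dots> = a \<bullet> e" using e by (simp add: a_def d_def inner_diff_left dot_square_norm)
      finally show ?thesis .
    qed
    have az: "norm (a - z) < r / 2"
    proof -
      have "norm (a - z) \<le> norm (x - z) + norm (d *\<^sub>R e)"
        using norm_triangle_ineq4[of "x - z" "d *\<^sub>R e"] by (simp add: a_def algebra_simps)
      also have "\<dots> < \<rho> + K * \<rho>" using xz dK d0 e by simp
      also have "\<dots> \<le> r / 2" using \<rho>(2) by (simp add: distrib_right)
      finally show ?thesis .
    qed
    have cb: "cball a s \<subseteq> ball z r" if "s \<le> r / 2" for s
    proof
      fix q assume "q \<in> cball a s"
      then show "q \<in> ball z r"
        using az that dist_triangle[of z q a] by (simp add: dist_norm norm_minus_commute)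
    qed
    have a_ball: "a \<in> ball z r" using cb[of 0] r by auto
    define g where "g = (\<Sum>b\<in>Basis. partial_deriv b \<phi> a *\<^sub>R b)"
    have g_inner: "(\<Sum>b\<in>Basis. partial_deriv b \<phi> a * (v \<bullet> b)) = g \<bullet> v" for v
      by (simp add: g_def inner_sum_left inner_commute[of v])
    have g_norm: "norm g \<le> ?n * G"
    proof -
      have "norm g \<le> (\<Sum>b\<in>(Basis::'a set). G)"
        unfolding g_def using grad[OF a_ball] by (intro sum_norm_le) auto
      then show ?thesis by simp
    qed
    \<comment> \<open>\<open>\<phi>\<close> is constant along \<open>e\<close>, so the Taylor bound
      for a step \<open>s\<close> along \<open>e\<close> reads
      \<open>s * \<bar>g \<bullet> e\<bar> \<le> s * (M * s)\<close>, false for the small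
      \<open>s\<close> chosen.\<close>
    have ge: "g \<bullet> e = 0"
    proof (rule ccontr)
      assume ne: "g \<bullet> e \<noteq> 0"
      define s where "s = min (r / 2) (\<bar>g \<bullet> e\<bar> / (2 * (M + 1)))"
      have s: "0 < s" "s \<le> r / 2"
        unfolding s_def using r ne GM by (simp_all only: min.cobounded1) auto
      have "\<bar>\<phi> (a + s *\<^sub>R e) - \<phi> a - g \<bullet> (s *\<^sub>R e)\<bar> \<le> M * (norm (s *\<^sub>R e))\<^sup>2"
        using taylor[OF cb, of "s *\<^sub>R e"] s e by (simp only: g_inner) simp
      then have "s * \<bar>g \<bullet> e\<bar> \<le> s * (M * s)"
        using s e by (simp add: \<phi>_e abs_mult power2_eq_square mult_ac)
      then have "\<bar>g \<bullet> e\<bar> \<le> M * s" using s by simp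
      also have "\<dots> \<le> (M + 1) * s" using s by simp
      also have "\<dots> \<le> \<bar>g \<bullet> e\<bar> / 2"
      proof -
        have "s \<le> \<bar>g \<bullet> e\<bar> / (2 * (M + 1))" by (simp add: s_def)
        then show ?thesis using GM by (simp add: field_simps)
      qed
      finally show False using ne by simp
    qed
    define N where "N = e - g"
    have eN: "e \<bullet> N = 1" using e ge by (simp add: N_def inner_diff_right dot_square_norm inner_commute)
    have N: "1 \<le> norm N" "norm N \<le> K" "N \<noteq> 0"
    proof -
      show "1 \<le> norm N" using Cauchy_Schwarz_ineq2[of e N] eN e by simp
      then show "N \<noteq> 0" by auto
      show "norm N \<le> K" using norm_triangle_ineq4[of e g] e g_norm by (simp add: N_def K_def)
    qed
    define y where "y = a + (R / norm N) *\<^sub>R N"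
    have expand: "(norm (v - c *\<^sub>R N))\<^sup>2 = (norm v)\<^sup>2 - 2 * c * (v \<bullet> N) + c\<^sup>2 * (norm N)\<^sup>2" for v c
      unfolding power2_norm_eq_inner
      by (simp add: inner_diff_left inner_diff_right inner_commute[of N v] power2_eq_square algebra_simps)
    have sq: "(dist y q)\<^sup>2 = (norm (q - a))\<^sup>2 - 2 * (R / norm N) * ((q - a) \<bullet> N) + R\<^sup>2" for q
    proof -
      have "(dist y q)\<^sup>2 = (norm ((q - a) - (R / norm N) *\<^sub>R N))\<^sup>2"
        by (simp add: dist_norm norm_minus_commute y_def algebra_simps)
      also have "\<dots> = (norm (q - a))\<^sup>2 - 2 * (R / norm N) * ((q - a) \<bullet> N) + (R / norm N)\<^sup>2 * (norm N)\<^sup>2"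
        using expand by blast
      also have "(R / norm N)\<^sup>2 * (norm N)\<^sup>2 = R\<^sup>2"
        using N by (simp add: power_divide)
      finally show ?thesis .
    qed
    have "ball y R \<subseteq> \<Omega>"
    proof
      fix q assume q: "q \<in> ball y R"
      \<comment> \<open>With \<open>v = q - a\<close>, membership in the ball becomes
        \<open>(norm v)\<^sup>2 < 2 * (R / norm N) * (v \<bullet> N)\<close>. By
        \<open>2 * R * M \<le> 1\<close> the Taylor error is then below
        \<open>v \<bullet> N\<close>, the height of \<open>q\<close> over the tangent plane.\<close>
      define v where "v = q - a"
      have "(dist y q)\<^sup>2 < R\<^sup>2" using q R by (intro power_strict_mono) auto
      then have v: "(norm v)\<^sup>2 < 2 * (R / norm N) * (v \<bullet> N)" using sq[of q] by (simp add: v_def)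
      have "v \<bullet> N \<le> norm v * norm N" by (rule norm_cauchy_schwarz)
      then have "2 * (R / norm N) * (v \<bullet> N) \<le> 2 * (R / norm N) * (norm v * norm N)"
        using R N by (intro mult_left_mono) auto
      also have "\<dots> = 2 * R * norm v" using N by simp
      finally have "norm v * norm v < 2 * R * norm v" using v by (simp add: power2_eq_square)
      then have "norm v < 2 * R" by (rule mult_right_less_imp_less) simp
      then have v_small: "norm v \<le> r / 2" using R(2) by linarith
      have "0 < 2 * (R / norm N) * (v \<bullet> N)"
        using v zero_le_power2[of "norm v"] by linarith
      then have vN: "0 < v \<bullet> N"
        using R(1) N(1) by (simp add: zero_less_mult_iff zero_less_divide_iff)
      have "2 * R * M * (v \<bullet> N) \<le> 1 * (v \<bullet> N)"
        using R(3) vN by (intro mult_right_mono) auto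
      also have "\<dots> \<le> norm N * (v \<bullet> N)" using N vN by (intro mult_right_mono) auto
      finally have "(2 * (R / norm N) * (v \<bullet> N)) * M \<le> v \<bullet> N"
        using N by (simp add: field_simps)
      moreover have "M * (norm v)\<^sup>2 < (2 * (R / norm N) * (v \<bullet> N)) * M" if "0 < M"
        using mult_strict_right_mono[OF v that] by (simp only: mult.commute[of M])
      ultimately have strict: "M * (norm v)\<^sup>2 < v \<bullet> N"
        using vN GM(2) by (cases "M = 0") auto
      have "\<bar>\<phi> (a + v) - \<phi> a - g \<bullet> v\<bar> \<le> M * (norm v)\<^sup>2"
        using taylor[OF cb[OF v_small]] by (simp only: g_inner)
      then have "\<phi> q < a \<bullet> e + g \<bullet> v + v \<bullet> N" using strict \<phi>a by (simp add: v_def)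
      also have "\<dots> = q \<bullet> e" by (simp add: N_def v_def inner_diff_right inner_diff_left inner_commute)
      finally have "\<phi> q < q \<bullet> e" .
      moreover have "q \<in> ball z r"
        using cb[OF v_small] by (auto simp: v_def dist_norm norm_minus_commute subset_iff)
      ultimately show "q \<in> \<Omega>" using mem_iff by blast
    qed
    moreover
    have "(dist y x)\<^sup>2 = d * d - 2 * (d * (R / norm N)) + R\<^sup>2"
      using sq[of x] e eN by (simp add: a_def power2_eq_square)
    moreover have "R / K \<le> R / norm N" using R N by (intro divide_left_mono) auto
    then have "d * d \<le> d * (R / norm N)" "d * (R / K) \<le> d * (R / norm N)"
      using d0 dK \<rho>(3) by (intro mult_left_mono; linarith)+
    ultimately have D: "(dist y x)\<^sup>2 \<le> R\<^sup>2 - d * (R / K)"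
      by linarith
    have "0 < d * (R / K)" using d0 R K by simp
    with D have "(dist y x)\<^sup>2 < R\<^sup>2" by simp
    then have yx: "dist y x < R" using R by (simp add: power_less_imp_less_base)
    have "d * (R / K) \<le> (R + dist y x) * (R - dist y x)" using D by (simp add: power2_eq_square algebra_simps)
    also have "\<dots> \<le> (2 * R) * (R - dist y x)" using yx by (intro mult_right_mono) auto
    finally have "(2 * R) * (d / (2 * K)) \<le> (2 * R) * (R - dist y x)"
      by (simp add: mult.commute[of R d])
    then have gap: "d / (2 * K) \<le> R - dist y x"
      by (rule mult_left_le_imp_le) (use R in simp)
    \<comment> \<open>\<open>a\<close> is on the graph, hence outside, so the segment from
      \<open>x\<close> to \<open>a\<close>, of length \<open>d\<close>, meets the frontier.\<close>
    have "infdist x (frontier \<Omega>) \<le> d"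
    proof -
      have "a \<notin> \<Omega>" using \<phi>a mem_iff[OF a_ball] by simp
      then obtain q where q: "q \<in> closed_segment x a" "q \<in> frontier \<Omega>"
        using connected_Int_frontier[of "closed_segment x a" \<Omega>] x by auto
      have "infdist x (frontier \<Omega>) \<le> dist x q" using q by (intro infdist_le)
      also have "\<dots> \<le> dist x a" using q(1) dist_in_closed_segment[OF q(1)] by (simp add: dist_commute)
      also have "\<dots> = d" using d0 e by (simp add: a_def dist_norm)
      finally show ?thesis .
    qed
    then have "1 / (2 * K) * infdist x (frontier \<Omega>) \<le> 1 / (2 * K) * d"
      using K by (intro mult_left_mono) auto
    with gap have "1 / (2 * K) * infdist x (frontier \<Omega>) \<le> R - dist y x" by simp
    then show ?thesis using \<open>ball y R \<subseteq> \<Omega>\<close> yx by (metis mem_ball)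
  qed
  then show ?thesis
    using \<rho>(1) R(1) K by (intro exI[of _ \<rho>] exI[of _ R] exI[of _ "1 / (2 * K)"] conjI) auto
qed

section \<open>Growth of time increments\<close>

lemma compact_uniform_constant:
  fixes P :: "real \<Rightarrow> 'a::metric_space \<Rightarrow> bool"
  assumes "compact K"
    and loc: "\<And>z. z \<in> K \<Longrightarrow> \<exists>r>0. \<exists>C>0. \<forall>x\<in>K \<inter> ball z r. P C x"
    and mono: "\<And>C C' x. P C x \<Longrightarrow> 0 < C' \<Longrightarrow> C' \<le> C \<Longrightarrow> P C' x"
  shows "\<exists>C>0. \<forall>x\<in>K. P C x"
proof -
  obtain r C where rC: "\<And>z. z \<in> K \<Longrightarrow> 0 < r z \<and> 0 < C z \<and> (\<forall>x\<in>K \<inter> ball z (r z). P (C z) x)"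
    using loc by metis
  obtain F where F: "F \<subseteq> K" "finite F" "K \<subseteq> (\<Union>z\<in>F. ball z (r z))"
    by (rule compactE_image[OF \<open>compact K\<close>, of K "\<lambda>z. ball z (r z)"]) (use rC in auto)
  \<comment> \<open>The extra \<open>1\<close> keeps \<open>Min\<close> meaningful when the subcover
    is empty.\<close>
  define C0 where "C0 = Min (insert 1 (C ` F))"
  have "0 < C0"
    unfolding C0_def using F rC by (subst Min_gr_iff) auto
  moreover have "P C0 x" if x: "x \<in> K" for x
  proof -
    obtain z where z: "z \<in> F" "x \<in> ball z (r z)" using F(3) x by blast
    then have "P (C z) x" using rC F(1) x by blast
    moreover have "C0 \<le> C z" unfolding C0_def using F z by (intro Min_le) auto
    ultimately show ?thesis using mono \<open>0 < C0\<close> by blast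
  qed
  ultimately show ?thesis by blast
qed

text \<open>The equation is split into a time derivative and \<open>has_laplacian\<close>, the form
  that \<open>spacetime_minimum\<close> takes. Connectedness, a point with \<open>f > 0\<close> and
  interior balls are hypotheses of the lemmas that use them.\<close>

locale quenching =
  fixes \<Omega> :: "'a::euclidean_space set" and p :: real and f :: "'a \<Rightarrow> real"
    and u :: "'a \<Rightarrow> real \<Rightarrow> real" and T :: real
  assumes open_domain: "open \<Omega>" and bounded_domain: "bounded \<Omega>"
    and p_pos: "0 < p" and T_pos: "0 < T"
    and f_nonneg: "\<And>x. x \<in> closure \<Omega> \<Longrightarrow> 0 \<le> f x"
    and f_cont: "continuous_on (closure \<Omega>) f"
    and u_cont: "continuous_on (closure \<Omega> \<times> {0..<T}) (\<lambda>(x, t). u x t)"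
    and u_less_1: "\<And>x t. x \<in> closure \<Omega> \<Longrightarrow> 0 \<le> t \<Longrightarrow> t < T \<Longrightarrow> u x t < 1"
    and u_deriv: "\<And>x t. x \<in> \<Omega> \<Longrightarrow> 0 < t \<Longrightarrow> t < T \<Longrightarrow>
      (u x has_real_derivative laplacian (\<lambda>y. u y t) x + f x * (1 - u x t) powr (- p)) (at t)"
    and u_laplacian: "\<And>x t. x \<in> \<Omega> \<Longrightarrow> 0 < t \<Longrightarrow> t < T \<Longrightarrow>
      has_laplacian (\<lambda>y. u y t) x (laplacian (\<lambda>y. u y t) x)"
    and u_frontier: "\<And>x t. x \<in> frontier \<Omega> \<Longrightarrow> 0 < t \<Longrightarrow> t < T \<Longrightarrow> u x t = 0"
    and u_initial: "\<And>x. x \<in> \<Omega> \<Longrightarrow> u x 0 = 0"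
begin

section \<open>Elementary properties of the solution\<close>

lemma frontier_subset_closure: "frontier \<Omega> \<subseteq> closure \<Omega>"
  by (auto simp: frontier_def)

text \<open>The problem prescribes \<open>0\<close> at time 0 inside and at positive times on the
  frontier; the corner values follow by continuity in time.\<close>

lemma u_initial_closure: "u x 0 = 0" if x: "x \<in> closure \<Omega>"
proof (cases "x \<in> \<Omega>")
  case False
  then have fr: "x \<in> frontier \<Omega>"
    using x open_domain by (auto simp: frontier_def interior_open)
  have "continuous_on {0..<T} (\<lambda>t. case (x, t) of (x, t) \<Rightarrow> u x t)"
    by (rule continuous_on_compose2[OF u_cont]) (auto intro!: continuous_intros x)
  then have "((\<lambda>t. u x t) \<longlongrightarrow> u x 0) (at 0 within {0..<T})"
    using T_pos by (auto simp: continuous_on_def)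
  then have "((\<lambda>t. u x t) \<longlongrightarrow> u x 0) (at 0 within {0..T / 2})"
    by (rule tendsto_within_subset) (use T_pos in auto)
  then have "((\<lambda>t. u x t) \<longlongrightarrow> u x 0) (at_right 0)"
    using T_pos by (simp add: at_within_Icc_at_right)
  moreover have "\<forall>\<^sub>F t in at_right 0. u x t = 0"
    unfolding eventually_at_right_field using u_frontier[OF fr] T_pos by auto
  then have "((\<lambda>t. u x t) \<longlongrightarrow> 0) (at_right 0)"
    by (rule tendsto_eventually)
  ultimately show ?thesis
    using tendsto_unique by (metis trivial_limit_at_right_real)
qed (rule u_initial)

lemma u_frontier_all: "u x t = 0" if "x \<in> frontier \<Omega>" "0 \<le> t" "t < T"
  using u_frontier[of x t] u_initial_closure[of x] that frontier_subset_closure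
  by (cases "t = 0") auto

lemma u_shift_cont:
  assumes "B \<subseteq> closure \<Omega>" "0 \<le> s + h" "\<tau> + h < T"
  shows "continuous_on (B \<times> {s..\<tau>}) (\<lambda>z. u (fst z) (snd z + h))"
proof -
  have "continuous_on (B \<times> {s..\<tau>}) (\<lambda>z. case (fst z, snd z + h) of (x, t) \<Rightarrow> u x t)"
    by (rule continuous_on_compose2[OF u_cont]) (use assms in \<open>auto intro!: continuous_intros\<close>)
  then show ?thesis by simp
qed

lemma u_bounded_away:
  assumes "\<tau> < T"
  obtains m where "0 < m" "\<And>x t. x \<in> closure \<Omega> \<Longrightarrow> 0 \<le> t \<Longrightarrow> t \<le> \<tau> \<Longrightarrow> m \<le> 1 - u x t"
proof (cases "closure \<Omega> \<times> {0..\<tau>} = {}")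
  case True
  then show ?thesis by (intro that[of 1]) auto
next
  case False
  have "continuous_on (closure \<Omega> \<times> {0..\<tau>}) (\<lambda>z. 1 - u (fst z) (snd z))"
    using u_shift_cont[of "closure \<Omega>" 0 0 \<tau>] assms by (intro continuous_intros) auto
  moreover have "compact (closure \<Omega> \<times> {0..\<tau>})"
    using bounded_domain by (intro compact_Times) (auto simp: compact_closure)
  ultimately obtain z where z: "z \<in> closure \<Omega> \<times> {0..\<tau>}"
    "\<forall>y\<in>closure \<Omega> \<times> {0..\<tau>}. 1 - u (fst z) (snd z) \<le> 1 - u (fst y) (snd y)"
    using continuous_attains_inf[OF _ False] by blast
  show ?thesis
  proof (rule that[of "1 - u (fst z) (snd z)"])
    show "0 < 1 - u (fst z) (snd z)"
      using z(1) u_less_1[of "fst z" "snd z"] assms by auto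
    show "1 - u (fst z) (snd z) \<le> 1 - u x t" if "x \<in> closure \<Omega>" "0 \<le> t" "t \<le> \<tau>" for x t
      using z(2)[rule_format, of "(x, t)"] that by auto
  qed
qed

lemma f_bounded: obtains M where "0 \<le> M" "\<And>x. x \<in> closure \<Omega> \<Longrightarrow> f x \<le> M"
proof -
  have "compact (f ` closure \<Omega>)"
    using bounded_domain f_cont by (intro compact_continuous_image) (auto simp: compact_closure)
  then obtain M where "\<forall>y\<in>f ` closure \<Omega>. norm y \<le> M"
    using compact_imp_bounded[of "f ` closure \<Omega>"] unfolding bounded_iff by auto
  then have "f x \<le> max 0 M" if "x \<in> closure \<Omega>" for x
    using that by fastforce
  then show thesis by (intro that[of "max 0 M"]) auto
qed

text \<open>At a negative minimum the heat operator leaves the nonnegative source, while the bound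
  \<open>1 * u x0 t0\<close> is negative.\<close>

lemma u_nonneg:
  assumes "x \<in> closure \<Omega>" "0 \<le> t" "t < T"
  shows "0 \<le> u x t"
proof (rule minimum_principle[where B = \<Omega> and s = 0 and K = 1 and J = u and \<tau> = t])
  show "continuous_on (closure \<Omega> \<times> {0..t}) (\<lambda>(x, t). u x t)"
    using u_shift_cont[of "closure \<Omega>" 0 0 t] assms by (auto simp: case_prod_unfold)
next
  fix x0 t0 assume x0: "x0 \<in> \<Omega>" "0 < t0" "t0 \<le> t" "u x0 t0 < 0"
    and mn: "\<And>x t'. x \<in> closure \<Omega> \<Longrightarrow> 0 \<le> t' \<Longrightarrow> t' \<le> t \<Longrightarrow>
      exp (- 1 * t0) * u x0 t0 \<le> exp (- 1 * t') * u x t'"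
  have "laplacian (\<lambda>y. u y t0) x0 + f x0 * (1 - u x0 t0) powr (- p) - laplacian (\<lambda>y. u y t0) x0
      \<le> 1 * u x0 t0"
  proof (rule spacetime_minimum[OF open_domain x0(1,2)])
    show "exp (- 1 * t0) * u x0 t0 \<le> exp (- 1 * t') * u x t'"
      if "x \<in> \<Omega>" "0 < t'" "t' \<le> t0" for x t'
      using that x0(3) closure_subset by (intro mn) auto
  qed (use x0 assms in \<open>auto intro: u_deriv u_laplacian\<close>)
  moreover have "0 \<le> f x0"
    using f_nonneg x0 closure_subset by blast
  then have "0 \<le> f x0 * (1 - u x0 t0) powr (- p)" by simp
  ultimately show False using x0 by linarith
next
  show "0 \<le> u x 0" if "x \<in> closure \<Omega>" for x
    using u_initial_closure[OF that] by simp
  show "0 \<le> u x t'" if "x \<in> frontier \<Omega>" "0 \<le> t'" "t' \<le> t" for x t'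
    using u_frontier_all[OF that(1,2)] that assms by simp
qed (fact bounded_domain open_domain assms(1,2) order_refl)+

text \<open>At a negative minimum of \<open>J\<close> the function \<open>L\<close> below, linear in
  \<open>u\<close> and \<open>\<psi>\<close>, has the same minimum, and the argument becomes linear.
  The subsolution property is asked only where \<open>\<psi>\<close> is positive: elsewhere
  \<open>\<mu> = 0\<close>, and \<open>\<psi>\<close> drops out of \<open>L\<close>.\<close>

lemma comparison:
  assumes B: "open B" "B \<subseteq> \<Omega>" and s: "0 \<le> s" and h: "0 < h" and \<tau>: "\<tau> + h < T"
    and \<psi>_cont: "continuous_on (closure B \<times> {s..\<tau>}) (\<lambda>(x, t). \<psi> x t)"
    and sub: "\<And>x t. x \<in> B \<Longrightarrow> s < t \<Longrightarrow> t \<le> \<tau> \<Longrightarrow> 0 < \<psi> x t \<Longrightarrow>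
      \<exists>a l. (\<psi> x has_real_derivative a) (at t) \<and> has_laplacian (\<lambda>y. \<psi> y t) x l \<and> a \<le> l"
    and init: "\<And>x. x \<in> closure B \<Longrightarrow>
      h * max 0 (\<psi> x s) powr (p + 1) * (1 - u x s) powr (- p) \<le> u x (s + h) - u x s"
    and bdry: "\<And>x t. x \<in> frontier B \<Longrightarrow> s \<le> t \<Longrightarrow> t \<le> \<tau> \<Longrightarrow>
      h * max 0 (\<psi> x t) powr (p + 1) * (1 - u x t) powr (- p) \<le> u x (t + h) - u x t"
    and x: "x \<in> closure B" and t: "s \<le> t" "t \<le> \<tau>"
  shows "h * max 0 (\<psi> x t) powr (p + 1) * (1 - u x t) powr (- p) \<le> u x (t + h) - u x t"
proof -
  have clB: "closure B \<subseteq> closure \<Omega>" using B(2) by (rule closure_mono)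
  have \<tau>T: "\<tau> < T" using \<tau> h by simp
  obtain m where m: "0 < m" "\<And>x t. x \<in> closure \<Omega> \<Longrightarrow> 0 \<le> t \<Longrightarrow> t \<le> \<tau> \<Longrightarrow> m \<le> 1 - u x t"
    by (rule u_bounded_away[OF \<tau>T], rule that)
  obtain M where M: "0 \<le> M" "\<And>x. x \<in> closure \<Omega> \<Longrightarrow> f x \<le> M"
    by (rule f_bounded, rule that)
  \<comment> \<open>A bound on the cylinder for the slope
    \<open>f x * (p * (1 - u x t) powr (- p - 1))\<close> of the source term, plus 1 for
    strictness.\<close>
  define K where "K = p * M * m powr (- p - 1) + 1"
  define \<Phi> where "\<Phi> x t = max 0 (\<psi> x t) powr (p + 1) * (1 - u x t) powr (- p)" for x t
  define J where "J x t = u x (t + h) - u x t - h * \<Phi> x t" for x t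
  have w_pos: "0 < 1 - u x t" if "x \<in> closure B" "s \<le> t" "t \<le> \<tau>" for x t
    using u_less_1[of x t] that s \<tau>T clB by auto
  have "0 \<le> J x t"
  proof (rule minimum_principle[where B = B and K = K and J = J, OF _ B(1) _ _ _ _ x t])
    show "bounded B" using bounded_domain B(2) bounded_subset by blast
    show "0 \<le> J x s" if "x \<in> closure B" for x
      using init[OF that] by (simp add: J_def \<Phi>_def mult_ac)
    show "0 \<le> J x t" if "x \<in> frontier B" "s \<le> t" "t \<le> \<tau>" for x t
      using bdry[OF that] by (simp add: J_def \<Phi>_def mult_ac)
    have "continuous_on (closure B \<times> {s..\<tau>}) (\<lambda>z. u (fst z) (snd z + 0))"
      "continuous_on (closure B \<times> {s..\<tau>}) (\<lambda>z. u (fst z) (snd z + h))"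
      using u_shift_cont[OF clB, of s 0 \<tau>] u_shift_cont[OF clB, of s h \<tau>] s h \<tau>T \<tau> by auto
    moreover have "continuous_on (closure B \<times> {s..\<tau>}) (\<lambda>z. \<psi> (fst z) (snd z))"
      using \<psi>_cont by (simp add: case_prod_unfold)
    moreover have "0 < 1 - u (fst z) (snd z)" if "z \<in> closure B \<times> {s..\<tau>}" for z
      using w_pos[of "fst z" "snd z"] that by auto
    then have "\<forall>z\<in>closure B \<times> {s..\<tau>}. 0 \<le> 1 - u (fst z) (snd z + 0) \<and>
        (1 - u (fst z) (snd z + 0) = 0 \<longrightarrow> 0 < - p)"
      by (simp add: less_imp_le order.strict_implies_not_eq)
    moreover have "\<forall>z\<in>closure B \<times> {s..\<tau>}. 0 \<le> max 0 (\<psi> (fst z) (snd z)) \<and>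
        (max 0 (\<psi> (fst z) (snd z)) = 0 \<longrightarrow> 0 < p + 1)"
      using p_pos by simp
    ultimately have "continuous_on (closure B \<times> {s..\<tau>}) (\<lambda>z. u (fst z) (snd z + h) - u (fst z) (snd z + 0)
        - h * (max 0 (\<psi> (fst z) (snd z)) powr (p + 1) * (1 - u (fst z) (snd z + 0)) powr (- p)))"
      by (intro continuous_on_diff continuous_on_mult continuous_on_const continuous_on_max continuous_on_powr')
    then show "continuous_on (closure B \<times> {s..\<tau>}) (\<lambda>(x, t). J x t)"
      by (simp add: J_def \<Phi>_def case_prod_unfold)
  next
    fix x0 t0 assume x0: "x0 \<in> B" and t0: "s < t0" "t0 \<le> \<tau>" and neg: "J x0 t0 < 0"
      and mn: "\<And>x t. x \<in> closure B \<Longrightarrow> s \<le> t \<Longrightarrow> t \<le> \<tau> \<Longrightarrow>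
        exp (- K * t0) * J x0 t0 \<le> exp (- K * t) * J x t"
    define w0 where "w0 = 1 - u x0 t0"
    define wh where "wh = 1 - u x0 (t0 + h)"
    define \<mu> where "\<mu> = max 0 (\<psi> x0 t0) / w0"
    define A where "A = h * ((p + 1) * \<mu> powr p)"
    define C where "C = h * (p * \<mu> powr (p + 1))"
    \<comment> \<open>By Young's inequality \<open>\<Phi>\<close> is the supremum over \<open>\<mu> \<ge> 0\<close> of
      \<open>(p + 1) \<mu>\<^sup>p \<psi> - p \<mu>\<^sup>p\<^sup>+\<^sup>1 (1 - u)\<close>, attained at \<open>(x0, t0)\<close> by the present \<open>\<mu>\<close>: so \<open>L\<close> is
      a linear function of \<open>u\<close> and \<open>\<psi>\<close> that touches \<open>J\<close> from above at the minimum.\<close>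
    define L where "L x t = u x (t + h) - u x t - (A * \<psi> x t - C * (1 - u x t))" for x t
    have x0': "x0 \<in> closure B" "x0 \<in> \<Omega>" "x0 \<in> closure \<Omega>"
      using x0 B closure_subset by blast+
    have w0: "0 < w0" using w_pos x0' t0 by (auto simp: w0_def)
    have wh: "0 < wh" using u_less_1[of x0 "t0 + h"] x0' t0 s h \<tau> by (auto simp: wh_def)
    have \<mu>: "0 \<le> \<mu>" using w0 by (simp add: \<mu>_def)
    have A: "0 \<le> A" using h p_pos by (simp add: A_def)
    have JL: "J x t \<le> L x t" if "x \<in> closure B" "s \<le> t" "t \<le> \<tau>" for x t
    proof -
      have "(p + 1) * \<mu> powr p * \<psi> x t - p * \<mu> powr (p + 1) * (1 - u x t)
        \<le> (p + 1) * \<mu> powr p * max 0 (\<psi> x t) - p * \<mu> powr (p + 1) * (1 - u x t)"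
        using p_pos by (intro diff_right_mono mult_left_mono) auto
      also have "\<dots> \<le> \<Phi> x t"
        unfolding \<Phi>_def by (rule young_powr[OF p_pos w_pos[OF that] \<mu>]) simp
      finally have "h * ((p + 1) * \<mu> powr p * \<psi> x t - p * \<mu> powr (p + 1) * (1 - u x t)) \<le> h * \<Phi> x t"
        using h by simp
      then show ?thesis
        by (simp add: J_def L_def A_def C_def algebra_simps)
    qed
    have \<Phi>0: "\<Phi> x0 t0 = \<mu> powr (p + 1) * w0"
    proof -
      have "\<mu> powr (p + 1) = max 0 (\<psi> x0 t0) powr (p + 1) / (w0 powr p * w0)"
        unfolding \<mu>_def using w0 by (simp add: powr_divide powr_add)
      then show ?thesis
        using w0 by (simp add: \<Phi>_def w0_def[symmetric] powr_minus_divide)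
    qed
    have A\<psi>: "A * \<psi> x0 t0 = h * ((p + 1) * (\<mu> powr (p + 1) * w0))"
    proof (cases "0 < \<psi> x0 t0")
      case True
      then have "\<psi> x0 t0 = \<mu> * w0" "\<mu> powr (p + 1) = \<mu> powr p * \<mu>"
        using w0 \<mu> by (auto simp: \<mu>_def powr_add)
      then show ?thesis by (simp add: A_def)
    next
      case False
      \<comment> \<open>Both sides vanish, because \<open>0 powr p = 0\<close> and
        \<open>0 powr (p + 1) = 0\<close>.\<close>
      then have "\<mu> = 0" by (simp add: \<mu>_def)
      then show ?thesis using p_pos by (simp add: A_def)
    qed
    have JL0: "L x0 t0 = J x0 t0"
    proof -
      have "L x0 t0 = u x0 (t0 + h) - u x0 t0 - (A * \<psi> x0 t0 - C * w0)"
        by (simp add: L_def w0_def)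
      then show ?thesis
        unfolding A\<psi> J_def \<Phi>0 C_def by (simp add: algebra_simps)
    qed
    have "\<exists>a l. ((\<lambda>t. A * \<psi> x0 t) has_real_derivative a) (at t0) \<and>
      has_laplacian (\<lambda>y. A * \<psi> y t0) x0 l \<and> a \<le> l"
    proof (cases "0 < \<psi> x0 t0")
      case True
      then obtain a l where "(\<psi> x0 has_real_derivative a) (at t0)"
        "has_laplacian (\<lambda>y. \<psi> y t0) x0 l" "a \<le> l"
        using sub[OF x0 t0] by blast
      then show ?thesis
        using A by (intro exI[of _ "A * a"] exI[of _ "A * l"])
          (auto intro!: DERIV_cmult has_laplacian_cmult mult_left_mono)
    next
      case False
      then have "A = 0" using p_pos by (simp add: A_def \<mu>_def)
      then show ?thesis
        by (intro exI[of _ 0]) (auto intro: has_laplacian_const)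
    qed
    then obtain a l where \<psi>: "((\<lambda>t. A * \<psi> x0 t) has_real_derivative a) (at t0)"
      "has_laplacian (\<lambda>y. A * \<psi> y t0) x0 l" "a \<le> l" by blast
    have t0T: "0 < t0" "t0 < T" "0 < t0 + h" "t0 + h < T" using t0 \<tau> s h by auto
    note u0 = u_deriv[OF x0'(2) t0T(1,2)] u_laplacian[OF x0'(2) t0T(1,2)]
    note uh = u_deriv[OF x0'(2) t0T(3,4)] u_laplacian[OF x0'(2) t0T(3,4)]
    define l0 where "l0 = laplacian (\<lambda>y. u y t0) x0"
    define lh where "lh = laplacian (\<lambda>y. u y (t0 + h)) x0"
    have "((\<lambda>t. u x0 (t + h) - u x0 t - (A * \<psi> x0 t - (C - C * u x0 t))) has_real_derivative
      (lh + f x0 * wh powr (- p)) - (l0 + f x0 * w0 powr (- p))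
        - (a - (0 - C * (l0 + f x0 * w0 powr (- p))))) (at t0)"
      unfolding l0_def lh_def w0_def wh_def
      by (intro DERIV_diff DERIV_cmult DERIV_const u0(1) \<psi>(1) DERIV_shift[THEN iffD1, OF uh(1)])
    then have Ld: "(L x0 has_real_derivative
      (lh + f x0 * wh powr (- p)) - (1 + C) * (l0 + f x0 * w0 powr (- p)) - a) (at t0)"
      by (simp add: L_def[abs_def] algebra_simps)
    have "has_laplacian (\<lambda>y. u y (t0 + h) - u y t0 - (A * \<psi> y t0 - (C - C * u y t0))) x0
      (lh - l0 - (l - (0 - C * l0)))"
      unfolding l0_def lh_def
      by (intro has_laplacian_diff has_laplacian_cmult has_laplacian_const u0(2) uh(2) \<psi>(2))
    then have Ll: "has_laplacian (\<lambda>y. L y t0) x0 (lh - l0 - (l - (0 - C * l0)))"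
      by (simp add: L_def right_diff_distrib)
    have "(lh + f x0 * wh powr (- p)) - (1 + C) * (l0 + f x0 * w0 powr (- p)) - a
        - (lh - l0 - (l - (0 - C * l0))) \<le> K * L x0 t0"
    proof (rule spacetime_minimum[OF B(1) x0 t0(1) _ Ld Ll])
      fix x t assume "x \<in> B" "s < t" "t \<le> t0"
      then have *: "x \<in> closure B" "s \<le> t" "t \<le> \<tau>" using t0 closure_subset by auto
      show "exp (- K * t0) * L x0 t0 \<le> exp (- K * t) * L x t"
        using order_trans[OF mn[OF *] mult_left_mono[OF JL[OF *], of "exp (- K * t)"]]
        unfolding JL0 by simp
    qed
    \<comment> \<open>The Laplacians of \<open>u\<close> cancel by the equation, and
      \<open>l - a \<ge> 0\<close> is dropped.\<close>
    then have 1: "f x0 * wh powr (- p) - f x0 * w0 powr (- p) - C * (f x0 * w0 powr (- p)) \<le> K * J x0 t0"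
      using \<psi>(3) unfolding JL0 by (simp add: algebra_simps)
    have f0: "0 \<le> f x0" "f x0 \<le> M" using f_nonneg M x0' by auto
    \<comment> \<open>\<open>q\<close> is the derivative of the source term in \<open>u\<close> at
      \<open>(x0, t0)\<close>. By the choice of \<open>C\<close> the tangent-plane term equals
      \<open>q * (h * \<Phi> x0 t0)\<close> exactly, so the source terms sum to at least
      \<open>q * J x0 t0\<close>; with \<open>q < K\<close> and \<open>J x0 t0 < 0\<close> this is
      absurd.\<close>
    define q where "q = f x0 * (p * w0 powr (- p - 1))"
    have "f x0 * (p * w0 powr (- p - 1) * (w0 - wh)) \<le> f x0 * (wh powr (- p) - w0 powr (- p))"
      using convex_powr_neg[OF p_pos w0 wh] f0 by (intro mult_left_mono)
    then have "q * (w0 - wh) \<le> f x0 * wh powr (- p) - f x0 * w0 powr (- p)"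
      by (simp add: q_def right_diff_distrib mult.assoc)
    moreover have "w0 powr (- p) = w0 powr (- p - 1) * w0"
      using w0 by (simp add: powr_diff)
    then have "C * (f x0 * w0 powr (- p)) = q * (h * \<Phi> x0 t0)"
      by (simp add: C_def \<Phi>0 q_def)
    moreover have "J x0 t0 = (w0 - wh) - h * \<Phi> x0 t0"
      by (simp add: J_def w0_def wh_def)
    then have "q * J x0 t0 = q * (w0 - wh) - q * (h * \<Phi> x0 t0)"
      by (simp only: right_diff_distrib)
    ultimately have 2: "q * J x0 t0 \<le> K * J x0 t0"
      using 1 by linarith
    have "w0 powr (- p - 1) \<le> m powr (- p - 1)"
      using m(2)[of x0 t0] m(1) x0' t0 s p_pos by (intro powr_mono2') (auto simp: w0_def)
    then have "q \<le> M * (p * m powr (- p - 1))"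
      unfolding q_def using f0 p_pos M by (intro mult_mono) auto
    then have "q < K"
      by (simp add: K_def mult_ac)
    then show False
      using 2 neg by (simp add: mult_le_cancel_right)
  qed
  then show ?thesis by (simp add: J_def \<Phi>_def mult_ac)
qed

text \<open>This is \<open>comparison\<close> with \<open>\<psi> = 0\<close>, where
  \<open>0 powr (p + 1) = 0\<close>; the initial inequality is then \<open>u_nonneg\<close>.\<close>

lemma u_mono:
  assumes "x \<in> closure \<Omega>" "0 \<le> t" "0 \<le> h" "t + h < T"
  shows "u x t \<le> u x (t + h)"
proof (cases "h = 0")
  case False
  have "h * max 0 0 powr (p + 1) * (1 - u x t) powr (- p) \<le> u x (t + h) - u x t"
  proof (rule comparison[where B = \<Omega> and s = 0 and \<tau> = t and \<psi> = "\<lambda>_ _. 0"])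
    show "h * max 0 0 powr (p + 1) * (1 - u x 0) powr (- p) \<le> u x (0 + h) - u x 0"
      if "x \<in> closure \<Omega>" for x
      using u_initial_closure[OF that] u_nonneg[OF that, of h] assms by simp
    show "h * max 0 0 powr (p + 1) * (1 - u x s) powr (- p) \<le> u x (s + h) - u x s"
      if "x \<in> frontier \<Omega>" "0 \<le> s" "s \<le> t" for x s
      using u_frontier_all[OF that(1)] that assms by simp
  qed (use assms False open_domain in auto)
  then show ?thesis by simp
qed simp

text \<open>The bump grows linearly in time and vanishes on the sphere, where
  \<open>u \<ge> 0\<close> suffices; inside, \<open>u \<ge> 0\<close> makes the source at least
  \<open>c\<close>.\<close>

lemma u_lower_bump:
  assumes r: "0 < r" and sub: "cball y r \<subseteq> \<Omega>" and c: "0 < c" "\<And>x. x \<in> cball y r \<Longrightarrow> c \<le> f x"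
  obtains \<eta> where "0 < \<eta>"
    "\<And>x t. x \<in> cball y r \<Longrightarrow> 0 \<le> t \<Longrightarrow> t < T \<Longrightarrow> t * (\<eta> * (r\<^sup>2 - (norm (x - y))\<^sup>2)\<^sup>2) \<le> u x t"
proof -
  let ?n = "real DIM('a)"
  define \<xi> where "\<xi> x = r\<^sup>2 - (norm (x - y))\<^sup>2" for x
  \<comment> \<open>Chosen so that the heat operator of the bump is at most \<open>c\<close>: the
    time derivative costs at most \<open>\<eta> * r ^ 4\<close>, the negative part of the Laplacian
    at most \<open>T * (\<eta> * (4 * ?n * r\<^sup>2))\<close>.\<close>
  define \<eta> where "\<eta> = c / (r ^ 4 + 4 * ?n * r\<^sup>2 * T)"
  have den: "0 < r ^ 4 + 4 * ?n * r\<^sup>2 * T"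
    using r T_pos by (intro add_pos_nonneg) auto
  have \<eta>: "0 < \<eta>" using den c by (simp add: \<eta>_def)
  have cl: "cball y r \<subseteq> closure \<Omega>" using sub closure_subset by blast
  have "0 \<le> u x t - t * (\<eta> * (\<xi> x)\<^sup>2)" if x: "x \<in> cball y r" and t: "0 \<le> t" "t < T" for x t
  proof (rule minimum_principle[where B = "ball y r" and s = 0 and K = 1 and \<tau> = t
        and J = "\<lambda>x t. u x t - t * (\<eta> * (\<xi> x)\<^sup>2)"])
    show "continuous_on (closure (ball y r) \<times> {0..t}) (\<lambda>(x, t). u x t - t * (\<eta> * (\<xi> x)\<^sup>2))"
      unfolding case_prod_unfold \<xi>_def
      using u_shift_cont[OF cl, of 0 0 t] t r by (intro continuous_intros) auto
    show "0 \<le> u x 0 - 0 * (\<eta> * (\<xi> x)\<^sup>2)" if "x \<in> closure (ball y r)" for x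
      using u_initial_closure[of x] that r cl by auto
    show "0 \<le> u x t' - t' * (\<eta> * (\<xi> x)\<^sup>2)" if "x \<in> frontier (ball y r)" "0 \<le> t'" "t' \<le> t" for x t'
    proof -
      have "\<xi> x = 0" "x \<in> closure \<Omega>"
        using that(1) r cl by (auto simp: \<xi>_def dist_norm norm_minus_commute)
      then show ?thesis using u_nonneg[of x t'] that t by simp
    qed
  next
    fix x0 t0 assume x0: "x0 \<in> ball y r" "0 < t0" "t0 \<le> t"
      and neg: "u x0 t0 - t0 * (\<eta> * (\<xi> x0)\<^sup>2) < 0"
      and mn: "\<And>x t'. x \<in> closure (ball y r) \<Longrightarrow> 0 \<le> t' \<Longrightarrow> t' \<le> t \<Longrightarrow>
        exp (- 1 * t0) * (u x0 t0 - t0 * (\<eta> * (\<xi> x0)\<^sup>2)) \<le> exp (- 1 * t') * (u x t' - t' * (\<eta> * (\<xi> x)\<^sup>2))"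
    have x0': "x0 \<in> \<Omega>" "x0 \<in> closure \<Omega>" "x0 \<in> cball y r" using x0 sub cl by auto
    have t0: "t0 < T" using x0 t by simp
    let ?N = "(norm (x0 - y))\<^sup>2"
    define l where "l = laplacian (\<lambda>y. u y t0) x0"
    define g where "g = (1 - u x0 t0) powr (- p)"
    have "has_laplacian (\<lambda>x. (\<lambda>a. (r\<^sup>2 - a)\<^sup>2) ((norm (x - y))\<^sup>2)) x0
        (4 * (\<lambda>_. 2) ?N * ?N + 2 * ?n * (\<lambda>a. - 2 * (r\<^sup>2 - a)) ?N)"
      by (rule has_laplacian_radial) (auto intro!: derivative_eq_intros)
    then have "has_laplacian (\<lambda>x. (\<xi> x)\<^sup>2) x0 (8 * ?N - 4 * ?n * \<xi> x0)"
      by (simp add: \<xi>_def algebra_simps)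
    then have lap: "has_laplacian (\<lambda>x. u x t0 - t0 * (\<eta> * (\<xi> x)\<^sup>2)) x0
        (l - t0 * (\<eta> * (8 * ?N - 4 * ?n * \<xi> x0)))"
      unfolding l_def using u_laplacian[OF x0'(1) x0(2) t0]
      by (intro has_laplacian_diff has_laplacian_cmult)
    have der: "((\<lambda>t. u x0 t - t * (\<eta> * (\<xi> x0)\<^sup>2)) has_real_derivative
        (l + f x0 * g) - 1 * (\<eta> * (\<xi> x0)\<^sup>2)) (at t0)"
      unfolding l_def g_def
      by (intro DERIV_diff DERIV_cmult_right u_deriv[OF x0'(1) x0(2) t0] DERIV_ident)
    have le: "(l + f x0 * g) - 1 * (\<eta> * (\<xi> x0)\<^sup>2) - (l - t0 * (\<eta> * (8 * ?N - 4 * ?n * \<xi> x0)))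
        \<le> 1 * (u x0 t0 - t0 * (\<eta> * (\<xi> x0)\<^sup>2))"
    proof (rule spacetime_minimum[OF open_ball x0(1,2) _ der lap])
      show "exp (- 1 * t0) * (u x0 t0 - t0 * (\<eta> * (\<xi> x0)\<^sup>2)) \<le> exp (- 1 * t') * (u x t' - t' * (\<eta> * (\<xi> x)\<^sup>2))"
        if "x \<in> ball y r" "0 < t'" "t' \<le> t0" for x t'
        using that x0(3) r by (intro mn) auto
    qed
    have "1 powr (- p) \<le> g"
      unfolding g_def using u_nonneg[of x0 t0] u_less_1[of x0 t0] x0 x0' t0 p_pos
      by (intro powr_mono2') auto
    then have fg: "c \<le> f x0 * g"
      using mult_mono[of c "f x0" 1 g] c(2)[OF x0'(3)] c(1) f_nonneg[OF x0'(2)] by simp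
    have N: "0 \<le> ?N" "?N \<le> r\<^sup>2"
      using x0(1) by (auto simp: dist_norm norm_minus_commute intro!: power_mono)
    then have \<xi>: "0 \<le> \<xi> x0" "\<xi> x0 \<le> r\<^sup>2" by (auto simp: \<xi>_def)
    have "(\<xi> x0)\<^sup>2 \<le> (r\<^sup>2)\<^sup>2" using \<xi> by (intro power_mono)
    then have "\<eta> * (\<xi> x0)\<^sup>2 \<le> \<eta> * r ^ 4"
      using \<eta> by (simp flip: power_mult)
    moreover have "t0 * (\<eta> * (4 * ?n * \<xi> x0)) \<le> T * (\<eta> * (4 * ?n * r\<^sup>2))"
      using x0(2) t0 \<eta> \<xi> by (intro mult_mono) auto
    moreover have "0 \<le> t0 * (\<eta> * (8 * ?N))" using x0 \<eta> N by simp
    moreover have "\<eta> * r ^ 4 + T * (\<eta> * (4 * ?n * r\<^sup>2)) = \<eta> * (r ^ 4 + 4 * ?n * r\<^sup>2 * T)"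
      by (simp add: algebra_simps)
    moreover have "\<dots> = c" using den by (simp add: \<eta>_def)
    ultimately show False
      using le neg fg unfolding right_diff_distrib mult_1 by linarith
  qed (use x t r in auto)
  then show thesis
    by (intro that[OF \<eta>]) (auto simp: \<xi>_def)
qed

section \<open>Lower bounds for the growth of \<open>u\<close> and their transport through the
  domain\<close>

text \<open>An incremental form of \<open>u\<^sub>t \<ge> \<kappa>\<^sup>p\<^sup>+\<^sup>1 (1 -
  u)\<^sup>-\<^sup>p\<close> after time \<open>s\<close>. The power sits on \<open>\<kappa>\<close>
  so that \<open>\<kappa>\<close> is itself a barrier value and enters the final bound
  linearly.\<close>

definition fast_growth :: "real \<Rightarrow> real \<Rightarrow> 'a \<Rightarrow> bool" where
  "fast_growth \<kappa> s x \<longleftrightarrow> (\<forall>t h. s \<le> t \<and> 0 < h \<and> t + h < T \<longrightarrow>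
     h * \<kappa> powr (p + 1) * (1 - u x t) powr (- p) \<le> u x (t + h) - u x t)"

lemma fast_growth_mono:
  assumes "fast_growth \<kappa> s x" "0 \<le> \<kappa>'" "\<kappa>' \<le> \<kappa>" "s \<le> s'"
  shows "fast_growth \<kappa>' s' x"
  unfolding fast_growth_def
proof (intro allI impI)
  fix t h assume th: "s' \<le> t \<and> 0 < h \<and> t + h < T"
  have "h * \<kappa>' powr (p + 1) * (1 - u x t) powr (- p) \<le> h * \<kappa> powr (p + 1) * (1 - u x t) powr (- p)"
    using assms th p_pos by (intro mult_right_mono mult_left_mono powr_mono2) auto
  also have "\<dots> \<le> u x (t + h) - u x t"
    using assms(1,4) th unfolding fast_growth_def by simp
  finally show "h * \<kappa>' powr (p + 1) * (1 - u x t) powr (- p) \<le> u x (t + h) - u x t" .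
qed

text \<open>At time 0 one has \<open>1 - u = 1\<close>, and \<open>u_lower_bump\<close> gives an
  increment of at least \<open>h * (\<eta> * (\<xi> x)\<^sup>2)\<close>. This dominates
  \<open>h * \<psi> x 0 powr (p + 1)\<close> because \<open>\<psi> x 0 \<le> 1\<close>. On the
  sphere \<open>\<psi>\<close> vanishes and \<open>u_mono\<close> is enough.\<close>

lemma fast_growth_initial:
  assumes r: "0 < r" "r \<le> 1" and sub: "cball y r \<subseteq> \<Omega>"
    and c: "0 < c" "\<And>x. x \<in> cball y r \<Longrightarrow> c \<le> f x"
  obtains \<kappa> where "0 < \<kappa>" "\<And>x. x \<in> cball y (r / 2) \<Longrightarrow> fast_growth \<kappa> 0 x"
proof -
  let ?n = "real DIM('a)"
  obtain \<eta> where \<eta>: "0 < \<eta>"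
    "\<And>x t. x \<in> cball y r \<Longrightarrow> 0 \<le> t \<Longrightarrow> t < T \<Longrightarrow> t * (\<eta> * (r\<^sup>2 - (norm (x - y))\<^sup>2)\<^sup>2) \<le> u x t"
    by (rule u_lower_bump[OF r(1) sub c], assumption, rule that)
  define \<zeta> where "\<zeta> = min 1 \<eta>"
  define \<xi> where "\<xi> x = r\<^sup>2 - (norm (x - y))\<^sup>2" for x
  define k where "k = 8 + 4 * ?n"
  \<comment> \<open>The Laplacian of \<open>(\<xi> x)\<^sup>2\<close> is
    \<open>8 * r\<^sup>2 - k * \<xi> x\<close>; this \<open>\<beta>\<close> is the value for which
    adding \<open>\<beta> * (\<xi> x)\<^sup>2\<close> completes the square, so the decay makes
    \<open>\<psi>\<close> a subsolution.\<close>
  define \<beta> where "\<beta> = k\<^sup>2 / (32 * r\<^sup>2)"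
  define \<psi> where "\<psi> x t = \<zeta> * (\<xi> x)\<^sup>2 * exp (- \<beta> * t)" for x t
  define \<kappa> where "\<kappa> = \<zeta> * (r\<^sup>2 / 2)\<^sup>2 * exp (- \<beta> * T)"
  have \<zeta>: "0 < \<zeta>" "\<zeta> \<le> 1" "\<zeta> \<le> \<eta>" using \<eta>(1) by (auto simp: \<zeta>_def)
  have \<beta>: "0 \<le> \<beta>" by (simp add: \<beta>_def)
  have \<kappa>: "0 < \<kappa>" using \<zeta> r by (simp add: \<kappa>_def)
  have cl: "cball y r \<subseteq> closure \<Omega>" using sub closure_subset by blast
  have N: "(norm (x - y))\<^sup>2 \<le> r\<^sup>2" if "x \<in> cball y r" for x
    using that by (auto simp: dist_norm norm_minus_commute intro!: power_mono)
  have main: "h * max 0 (\<psi> x t) powr (p + 1) * (1 - u x t) powr (- p) \<le> u x (t + h) - u x t"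
    if x: "x \<in> cball y r" and th: "0 \<le> t" "0 < h" "t + h < T" for x t h
  proof (rule comparison[where B = "ball y r" and s = 0 and \<tau> = t])
    show "continuous_on (closure (ball y r) \<times> {0..t}) (\<lambda>(x, t). \<psi> x t)"
      unfolding case_prod_unfold \<psi>_def \<xi>_def by (intro continuous_intros)
    show "\<exists>a l. (\<psi> x has_real_derivative a) (at t') \<and> has_laplacian (\<lambda>y. \<psi> y t') x l \<and> a \<le> l"
      if "x \<in> ball y r" "0 < t'" "t' \<le> t" "0 < \<psi> x t'" for x t'
    proof -
      let ?N = "(norm (x - y))\<^sup>2" and ?e = "\<zeta> * exp (- \<beta> * t')"
      have "has_laplacian (\<lambda>x. (\<lambda>a. (r\<^sup>2 - a)\<^sup>2) ((norm (x - y))\<^sup>2)) x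
          (4 * (\<lambda>_. 2) ?N * ?N + 2 * ?n * (\<lambda>a. - 2 * (r\<^sup>2 - a)) ?N)"
        by (rule has_laplacian_radial) (auto intro!: derivative_eq_intros)
      then have "has_laplacian (\<lambda>x. (\<xi> x)\<^sup>2) x (8 * r\<^sup>2 - k * \<xi> x)"
        by (simp add: \<xi>_def k_def algebra_simps)
      then have "has_laplacian (\<lambda>x. ?e * (\<xi> x)\<^sup>2) x (?e * (8 * r\<^sup>2 - k * \<xi> x))"
        by (rule has_laplacian_cmult)
      then have lap: "has_laplacian (\<lambda>y. \<psi> y t') x (?e * (8 * r\<^sup>2 - k * \<xi> x))"
        by (simp add: \<psi>_def mult_ac)
      have der: "(\<psi> x has_real_derivative ?e * (- \<beta> * (\<xi> x)\<^sup>2)) (at t')"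
        unfolding \<psi>_def[abs_def] by (auto intro!: derivative_eq_intros)
      have "8 * r\<^sup>2 - k * \<xi> x + \<beta> * (\<xi> x)\<^sup>2 = 8 * (r - k * \<xi> x / (16 * r))\<^sup>2"
        using r by (simp add: \<beta>_def power2_eq_square field_simps)
      then have "- \<beta> * (\<xi> x)\<^sup>2 \<le> 8 * r\<^sup>2 - k * \<xi> x"
        by (smt (verit) zero_le_power2 mult_minus_left)
      then have "?e * (- \<beta> * (\<xi> x)\<^sup>2) \<le> ?e * (8 * r\<^sup>2 - k * \<xi> x)"
        using \<zeta> by (intro mult_left_mono) auto
      then show ?thesis using lap der by blast
    qed
    show "h * max 0 (\<psi> x 0) powr (p + 1) * (1 - u x 0) powr (- p) \<le> u x (0 + h) - u x 0"
      if "x \<in> closure (ball y r)" for x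
    proof -
      have x: "x \<in> cball y r" using that r by simp
      have "\<xi> x \<le> 1" "0 \<le> \<xi> x"
        using N[OF x] power_le_one[of r 2] r unfolding \<xi>_def
        by (smt (verit) zero_le_power2)+
      then have "(\<xi> x)\<^sup>2 \<le> 1" by (simp add: power_le_one)
      then have \<psi>1: "0 \<le> \<psi> x 0" "\<psi> x 0 \<le> 1" "\<psi> x 0 \<le> \<eta> * (\<xi> x)\<^sup>2"
        using \<zeta> mult_mono[of \<zeta> 1 "(\<xi> x)\<^sup>2" 1] mult_right_mono[of \<zeta> \<eta> "(\<xi> x)\<^sup>2"]
        by (auto simp: \<psi>_def)
      have "\<psi> x 0 powr (p + 1) \<le> \<psi> x 0 powr 1"
        using \<psi>1 p_pos by (intro powr_mono') auto
      also have "\<dots> = \<psi> x 0" using \<psi>1 by simp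
      also have "\<dots> \<le> \<eta> * (\<xi> x)\<^sup>2" using \<psi>1 by simp
      finally have "h * \<psi> x 0 powr (p + 1) \<le> h * (\<eta> * (\<xi> x)\<^sup>2)"
        using th by simp
      also have "\<dots> \<le> u x h" using \<eta>(2)[OF x, of h] th by (simp add: \<xi>_def)
      finally show ?thesis
        using u_initial_closure[of x] x cl \<psi>1 by (auto simp: max_def)
    qed
    show "h * max 0 (\<psi> x t') powr (p + 1) * (1 - u x t') powr (- p) \<le> u x (t' + h) - u x t'"
      if "x \<in> frontier (ball y r)" "0 \<le> t'" "t' \<le> t" for x t'
    proof -
      have "\<xi> x = 0" "x \<in> closure \<Omega>"
        using that(1) r cl by (auto simp: \<xi>_def dist_norm norm_minus_commute)
      then show ?thesis
        using u_mono[of x t' h] that th by (simp add: \<psi>_def)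
    qed
  qed (use x th r sub in auto)
  have "fast_growth \<kappa> 0 x" if x: "x \<in> cball y (r / 2)" for x
    unfolding fast_growth_def
  proof (intro allI impI)
    fix t h assume th: "0 \<le> t \<and> 0 < h \<and> t + h < T"
    have "(norm (x - y))\<^sup>2 \<le> (r / 2)\<^sup>2"
      using x by (auto simp: dist_norm norm_minus_commute intro!: power_mono)
    also have "\<dots> \<le> r\<^sup>2 / 2" by (simp add: power2_eq_square)
    finally have "r\<^sup>2 / 2 \<le> \<xi> x" by (simp add: \<xi>_def)
    then have "\<kappa> \<le> \<psi> x t"
      unfolding \<kappa>_def \<psi>_def using \<zeta> \<beta> th
      by (intro mult_mono power_mono) (auto intro!: mult_left_mono)
    then have "h * \<kappa> powr (p + 1) * (1 - u x t) powr (- p)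
        \<le> h * max 0 (\<psi> x t) powr (p + 1) * (1 - u x t) powr (- p)"
      using \<kappa> th p_pos by (intro mult_right_mono mult_left_mono powr_mono2) auto
    also have "\<dots> \<le> u x (t + h) - u x t"
      using x th r by (intro main) auto
    finally show "h * \<kappa> powr (p + 1) * (1 - u x t) powr (- p) \<le> u x (t + h) - u x t" .
  qed
  then show thesis using that \<kappa> by blast
qed

text \<open>A Hopf-type barrier on the annulus between the radii \<open>r\<close> and
  \<open>R\<close>, started at \<open>t - d\<close> separately for each \<open>t\<close>:
  nonpositive at the start and on the outer sphere, at most \<open>\<kappa>\<close> on the inner
  one, and at time \<open>t\<close> bounded below linearly in \<open>R - dist y x\<close>.
  \<open>C\<close> is fixed before \<open>y\<close>, \<open>\<kappa>\<close> and \<open>s\<close>,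
  hence uniform over balls of the same radii.\<close>

lemma fast_growth_propagates:
  assumes r: "0 < r" "r < R" and d: "0 < d"
  obtains C where "0 < C" "\<And>y \<kappa> s x. 0 \<le> s \<Longrightarrow> 0 < \<kappa> \<Longrightarrow> ball y R \<subseteq> \<Omega> \<Longrightarrow>
    \<forall>z\<in>cball y r. fast_growth \<kappa> s z \<Longrightarrow> x \<in> ball y R \<Longrightarrow>
    fast_growth (\<kappa> * (C * (R - dist y x))) (s + d) x"
proof -
  let ?n = "real DIM('a)"
  \<comment> \<open>\<open>\<sigma> * d = R\<^sup>2\<close> makes the barrier nonpositive at the
    start; \<open>\<alpha>\<close> solves
    \<open>4 * \<alpha> * r\<^sup>2 = \<sigma> + 2 * ?n\<close>, the subsolution condition at its
    worst radius \<open>r\<close>; \<open>C\<close> comes from \<open>1 + y \<le> exp y\<close> and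
    \<open>R * (R - D) \<le> R\<^sup>2 - D\<^sup>2\<close>.\<close>
  define \<sigma> where "\<sigma> = R\<^sup>2 / d"
  define \<alpha> where "\<alpha> = (\<sigma> + 2 * ?n) / (4 * r\<^sup>2)"
  define C where "C = exp (- \<alpha> * R\<^sup>2) * \<alpha> * R"
  have R: "0 < R" using r by simp
  have \<sigma>: "0 < \<sigma>" using R d by (simp add: \<sigma>_def)
  have \<alpha>: "0 < \<alpha>" using \<sigma> r by (simp add: \<alpha>_def add_pos_nonneg)
  have C: "0 < C" using \<alpha> R by (simp add: C_def)
  have profile: "C * (R - D) \<le> exp (- \<alpha> * D\<^sup>2) - exp (- \<alpha> * R\<^sup>2)" if "0 \<le> D" "D \<le> R" for D
  proof -
    have "R * (R - D) \<le> (R + D) * (R - D)" using that by (intro mult_right_mono) auto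
    then have "exp (- \<alpha> * R\<^sup>2) * \<alpha> * (R * (R - D)) \<le> exp (- \<alpha> * R\<^sup>2) * \<alpha> * (R\<^sup>2 - D\<^sup>2)"
      using \<alpha> by (intro mult_left_mono) (auto simp: power2_eq_square algebra_simps)
    also have "\<dots> \<le> exp (- \<alpha> * R\<^sup>2) * (exp (\<alpha> * (R\<^sup>2 - D\<^sup>2)) - 1)"
      unfolding mult.assoc using exp_ge_add_one_self[of "\<alpha> * (R\<^sup>2 - D\<^sup>2)"]
      by (intro mult_left_mono) (linarith, simp)
    also have "\<dots> = exp (- \<alpha> * D\<^sup>2) - exp (- \<alpha> * R\<^sup>2)"
      by (simp add: right_diff_distrib flip: exp_add)
    finally show ?thesis by (simp add: C_def mult_ac)
  qed
  have "fast_growth (\<kappa> * (C * (R - dist y x))) (s + d) x"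
    if s: "0 \<le> s" and \<kappa>: "0 < \<kappa>" and sub: "ball y R \<subseteq> \<Omega>"
      and fast: "\<forall>z\<in>cball y r. fast_growth \<kappa> s z" and x: "x \<in> ball y R" for y \<kappa> s x
  proof (cases "dist y x \<le> r")
    case True
    have "C * (R - dist y x) \<le> exp (- \<alpha> * (dist y x)\<^sup>2)"
      using profile[of "dist y x"] x by (smt (verit) exp_gt_zero mem_ball zero_le_dist)
    also have "\<dots> \<le> 1" using \<alpha> by simp
    finally have "\<kappa> * (C * (R - dist y x)) \<le> \<kappa> * 1"
      using \<kappa> by (intro mult_left_mono) auto
    then show ?thesis
      using fast_growth_mono[OF fast[rule_format, of x]] True \<kappa> C x d by simp
  next
    case False
    show ?thesis
      unfolding fast_growth_def
    proof (intro allI impI)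
      fix t h assume th: "s + d \<le> t \<and> 0 < h \<and> t + h < T"
      define B where "B = ball y R - cball y r"
      define \<psi> where "\<psi> x t' = \<kappa> * (exp (- \<alpha> * ((norm (x - y))\<^sup>2 + \<sigma> * (t - t'))) - exp (- \<alpha> * R\<^sup>2))" for x t'
      have B: "open B" "B \<subseteq> \<Omega>" using sub by (auto simp: B_def)
      have "closure B \<subseteq> closure (ball y R)" by (intro closure_mono) (auto simp: B_def)
      then have clB: "closure B \<subseteq> cball y R" using R by simp
      have cl\<Omega>: "closure B \<subseteq> closure \<Omega>" using B(2) by (rule closure_mono)
      have "closure B \<subseteq> - ball y r" by (rule closure_minimal) (auto simp: B_def)
      then have frB: "dist y x = r \<or> dist y x = R" if "x \<in> frontier B" for x
        using that clB B(1) by (auto simp: frontier_def interior_open B_def)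
      have mono: "h * max 0 (\<psi> x t') powr (p + 1) * (1 - u x t') powr (- p) \<le> u x (t' + h) - u x t'"
        if "\<psi> x t' \<le> 0" "x \<in> closure B" "0 \<le> t'" "t' \<le> t" for x t'
        using that u_mono[of x t' h] cl\<Omega> th by (auto simp: max_def)
      have "h * max 0 (\<psi> x t) powr (p + 1) * (1 - u x t) powr (- p) \<le> u x (t + h) - u x t"
      proof (rule comparison[where B = B and s = "t - d" and \<tau> = t])
        show "continuous_on (closure B \<times> {t - d..t}) (\<lambda>(x, t). \<psi> x t)"
          unfolding case_prod_unfold \<psi>_def by (intro continuous_intros)
        show "x \<in> closure B" using x False closure_subset by (force simp: B_def)
        show "h * max 0 (\<psi> x (t - d)) powr (p + 1) * (1 - u x (t - d)) powr (- p)
            \<le> u x (t - d + h) - u x (t - d)" if "x \<in> closure B" for x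
        proof (rule mono)
          have "\<sigma> * d = R\<^sup>2" using d by (simp add: \<sigma>_def)
          then have "- \<alpha> * ((norm (x - y))\<^sup>2 + \<sigma> * (t - (t - d))) \<le> - \<alpha> * R\<^sup>2"
            using \<alpha> by simp
          then show "\<psi> x (t - d) \<le> 0"
            using \<kappa> by (simp only: \<psi>_def mult_le_0_iff exp_le_cancel_iff diff_le_0_iff_le) simp
        qed (use that th s d in auto)
        show "h * max 0 (\<psi> x t') powr (p + 1) * (1 - u x t') powr (- p) \<le> u x (t' + h) - u x t'"
          if x: "x \<in> frontier B" and t': "t - d \<le> t'" "t' \<le> t" for x t'
        proof (cases "dist y x = R")
          case True
          then have "- \<alpha> * ((norm (x - y))\<^sup>2 + \<sigma> * (t - t')) \<le> - \<alpha> * R\<^sup>2"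
            using \<alpha> \<sigma> t' by (simp add: dist_norm norm_minus_commute)
          then have "\<psi> x t' \<le> 0"
            using \<kappa> by (simp only: \<psi>_def mult_le_0_iff exp_le_cancel_iff diff_le_0_iff_le) simp
          then show ?thesis
            using x t' th s d by (intro mono) (auto simp: frontier_def)
        next
          case False
          then have "x \<in> cball y r" using frB[OF x] by simp
          then have "h * \<kappa> powr (p + 1) * (1 - u x t') powr (- p) \<le> u x (t' + h) - u x t'"
            using fast[rule_format, of x] th t' unfolding fast_growth_def by simp
          moreover have "exp (- \<alpha> * ((norm (x - y))\<^sup>2 + \<sigma> * (t - t'))) \<le> 1"
            using \<alpha> \<sigma> t' by simp
          then have "exp (- \<alpha> * ((norm (x - y))\<^sup>2 + \<sigma> * (t - t'))) - exp (- \<alpha> * R\<^sup>2) \<le> 1"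
            by (smt (verit) exp_gt_zero)
          then have "\<psi> x t' \<le> \<kappa> * 1"
            unfolding \<psi>_def using \<kappa> by (intro mult_left_mono) auto
          then have "h * max 0 (\<psi> x t') powr (p + 1) * (1 - u x t') powr (- p)
              \<le> h * \<kappa> powr (p + 1) * (1 - u x t') powr (- p)"
            using \<kappa> th p_pos by (intro mult_right_mono mult_left_mono powr_mono2) auto
          ultimately show ?thesis by simp
        qed
        show "\<exists>a l. (\<psi> x has_real_derivative a) (at t') \<and> has_laplacian (\<lambda>y. \<psi> y t') x l \<and> a \<le> l"
          if x: "x \<in> B" for x t'
        proof -
          let ?N = "(norm (x - y))\<^sup>2" and ?e = "\<lambda>a. exp (- \<alpha> * (a + \<sigma> * (t - t')))"
          have lap: "has_laplacian (\<lambda>x. (\<lambda>a. \<kappa> * (?e a - exp (- \<alpha> * R\<^sup>2))) ((norm (x - y))\<^sup>2)) x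
            (4 * (\<lambda>a. \<kappa> * \<alpha>\<^sup>2 * ?e a) ?N * ?N + 2 * ?n * (\<lambda>a. - \<kappa> * \<alpha> * ?e a) ?N)"
            by (rule has_laplacian_radial) (auto intro!: derivative_eq_intros simp: power2_eq_square)
          have der: "(\<psi> x has_real_derivative \<kappa> * \<alpha> * ?e ?N * \<sigma>) (at t')"
            unfolding \<psi>_def[abs_def] by (auto intro!: derivative_eq_intros)
          have "r\<^sup>2 \<le> ?N"
            using x r by (intro power_mono) (auto simp: B_def dist_norm norm_minus_commute)
          then have "4 * \<alpha> * r\<^sup>2 \<le> 4 * \<alpha> * ?N" using \<alpha> by simp
          moreover have "4 * \<alpha> * r\<^sup>2 = \<sigma> + 2 * ?n" using r by (simp add: \<alpha>_def)
          ultimately have "\<sigma> \<le> 4 * \<alpha> * ?N - 2 * ?n" by simp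
          then have "\<kappa> * \<alpha> * ?e ?N * \<sigma> \<le> \<kappa> * \<alpha> * ?e ?N * (4 * \<alpha> * ?N - 2 * ?n)"
            using \<kappa> \<alpha> by (intro mult_left_mono) auto
          also have "\<dots> = 4 * (\<kappa> * \<alpha>\<^sup>2 * ?e ?N) * ?N + 2 * ?n * (- \<kappa> * \<alpha> * ?e ?N)"
            by (simp add: power2_eq_square algebra_simps)
          finally show ?thesis
            using lap der unfolding \<psi>_def by blast
        qed
      qed (use B th s d in auto)
      moreover have "\<kappa> * (C * (R - dist y x)) \<le> \<psi> x t"
        using profile[of "dist y x"] \<kappa> x
        by (simp add: \<psi>_def dist_norm norm_minus_commute)
      then have "h * (\<kappa> * (C * (R - dist y x))) powr (p + 1) * (1 - u x t) powr (- p)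
          \<le> h * max 0 (\<psi> x t) powr (p + 1) * (1 - u x t) powr (- p)"
        using \<kappa> C x th p_pos by (intro mult_right_mono mult_left_mono powr_mono2) auto
      ultimately show "h * (\<kappa> * (C * (R - dist y x))) powr (p + 1) * (1 - u x t) powr (- p)
          \<le> u x (t + h) - u x t" by simp
    qed
  qed
  then show thesis using that C by blast
qed

text \<open>Induction along the connected domain. Each passage costs time; as \<open>P\<close> asks
  for every \<open>s > 0\<close>, a step can take its hypothesis at \<open>s / 2\<close> and spend
  \<open>s / 2\<close> as delay.\<close>

lemma fast_growth_interior:
  assumes "connected \<Omega>" "x1 \<in> \<Omega>" "0 < f x1" "y \<in> \<Omega>" "0 < s"
  shows "\<exists>\<kappa>>0. \<exists>r>0. \<forall>x\<in>cball y r. fast_growth \<kappa> s x"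
proof -
  define P where "P y \<longleftrightarrow> (\<forall>s>0. \<exists>\<kappa>>0. \<exists>r>0. \<forall>x\<in>cball y r. fast_growth \<kappa> s x)" for y
  have "P y"
  proof (rule connected_induction_simple[OF assms(1,2,4)])
    obtain r0 where r0: "0 < r0" "cball x1 r0 \<subseteq> \<Omega>"
      using open_domain assms(2) open_contains_cball by blast
    have "continuous_on \<Omega> f" using f_cont closure_subset continuous_on_subset by blast
    then have "isCont f x1" using open_domain assms(2) continuous_on_eq_continuous_at by blast
    then obtain r1 where r1: "0 < r1" "\<And>x. dist x x1 < r1 \<Longrightarrow> dist (f x) (f x1) < f x1 / 2"
      unfolding continuous_at_eps_delta using assms(3) by (meson half_gt_zero)
    define r where "r = min 1 (min r0 (r1 / 2))"
    have r: "0 < r" "r \<le> 1" "cball x1 r \<subseteq> \<Omega>" "r < r1"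
      using r0 r1(1) by (auto simp: r_def min_le_iff_disj)
    have "f x1 / 2 \<le> f x" if "x \<in> cball x1 r" for x
      using r1(2)[of x] that r(4) by (auto simp: dist_commute dist_real_def abs_if split: if_splits)
    then obtain \<kappa> where "0 < \<kappa>" "\<And>x. x \<in> cball x1 (r / 2) \<Longrightarrow> fast_growth \<kappa> 0 x"
      using fast_growth_initial[OF r(1-3), of "f x1 / 2"] assms(3) by (metis half_gt_zero)
    then show "P x1"
      unfolding P_def using r(1)
      by (metis fast_growth_mono half_gt_zero less_imp_le order_refl)
  next
    fix a assume "a \<in> \<Omega>"
    then obtain e where e: "0 < e" "ball a e \<subseteq> \<Omega>"
      using open_domain open_contains_ball by blast
    \<comment> \<open>The ball of radius \<open>3 * \<rho>\<close> about \<open>x\<close> stays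
      inside \<open>ball a e\<close>, and points within \<open>\<rho> / 2\<close> of
      \<open>y\<close> are at most \<open>5 / 2 * \<rho>\<close> from \<open>x\<close>, leaving a
      margin \<open>\<rho> / 2\<close>.\<close>
    define \<rho> where "\<rho> = e / 4"
    have \<rho>: "0 < \<rho>" "e = 4 * \<rho>" using e by (auto simp: \<rho>_def)
    have "P y" if x: "x \<in> ball a \<rho>" and y: "y \<in> ball a \<rho>" and P: "P x" for x y
      unfolding P_def
    proof (intro allI impI)
      fix s :: real assume s: "0 < s"
      then obtain \<kappa> r where \<kappa>: "0 < \<kappa>" "0 < r" "\<And>z. z \<in> cball x r \<Longrightarrow> fast_growth \<kappa> (s / 2) z"
        using P unfolding P_def by (metis half_gt_zero)
      define r' where "r' = min r \<rho>"
      have r': "0 < r'" "r' < 3 * \<rho>" using \<kappa> \<rho> by (auto simp: r'_def)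
      obtain C where C: "0 < C" "\<And>y \<kappa> s' x. 0 \<le> s' \<Longrightarrow> 0 < \<kappa> \<Longrightarrow> ball y (3 * \<rho>) \<subseteq> \<Omega> \<Longrightarrow>
          \<forall>z\<in>cball y r'. fast_growth \<kappa> s' z \<Longrightarrow> x \<in> ball y (3 * \<rho>) \<Longrightarrow>
          fast_growth (\<kappa> * (C * (3 * \<rho> - dist y x))) (s' + s / 2) x"
        by (rule fast_growth_propagates[OF r' half_gt_zero[OF s]], rule that)
      have ball: "ball x (3 * \<rho>) \<subseteq> \<Omega>"
      proof
        fix z assume "z \<in> ball x (3 * \<rho>)"
        then have "z \<in> ball a e" using x dist_triangle[of a z x] by (simp add: \<rho>(2))
        then show "z \<in> \<Omega>" using e by blast
      qed
      have "fast_growth (\<kappa> * (C * (\<rho> / 2))) s z" if z: "z \<in> cball y (\<rho> / 2)" for z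
      proof -
        have "dist x z \<le> dist x a + dist a y + dist y z"
          using dist_triangle[of x z y] dist_triangle[of x y a] by simp
        then have dz: "dist x z \<le> 5 / 2 * \<rho>"
          using x y z by (simp add: dist_commute)
        have "fast_growth (\<kappa> * (C * (3 * \<rho> - dist x z))) (s / 2 + s / 2) z"
          by (rule C(2)) (use s \<kappa> ball dz \<rho> in \<open>auto simp: r'_def\<close>)
        then show ?thesis
          by (rule fast_growth_mono) (use \<kappa> C(1) \<rho> dz in auto)
      qed
      moreover have "0 < \<kappa> * (C * (\<rho> / 2))" using \<kappa> C(1) \<rho> by simp
      ultimately show "\<exists>\<kappa>>0. \<exists>r>0. \<forall>x\<in>cball y r. fast_growth \<kappa> s x"
        using \<rho>(1) half_gt_zero by blast
    qed
    moreover have "ball a \<rho> \<subseteq> \<Omega>" using e \<rho> by auto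
    then have "openin (top_of_set \<Omega>) (ball a \<rho>)"
      by (simp add: open_subset)
    ultimately show "\<exists>U. openin (top_of_set \<Omega>) U \<and> a \<in> U \<and> (\<forall>x\<in>U. \<forall>y\<in>U. P x \<longrightarrow> P y)"
      using \<rho>(1) by (metis centre_in_ball)
  qed
  then show ?thesis using \<open>0 < s\<close> by (simp add: P_def)
qed

text \<open>The interior balls near \<open>z\<close> share one radius \<open>R\<close>, so their
  concentric halves lie in one compact set \<open>K\<close> inside the domain, with one
  \<open>\<kappa>\<close>. Propagation from radius \<open>R / 2\<close> to \<open>R\<close> gives a
  rate proportional to \<open>R - dist y x\<close>, hence to the distance.\<close>

lemma fast_growth_near_boundary:
  assumes conn: "connected \<Omega>" and x1: "x1 \<in> \<Omega>" "0 < f x1"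
    and ball: "\<And>z. z \<in> frontier \<Omega> \<Longrightarrow> \<exists>\<rho>>0. \<exists>R>0. \<exists>c>0. \<forall>x\<in>\<Omega> \<inter> ball z \<rho>.
      \<exists>y. ball y R \<subseteq> \<Omega> \<and> x \<in> ball y R \<and> c * infdist x (frontier \<Omega>) \<le> R - dist y x"
    and z: "z \<in> frontier \<Omega>" and s: "0 < s"
  shows "\<exists>r>0. \<exists>C>0. \<forall>x\<in>\<Omega> \<inter> ball z r. fast_growth (C * infdist x (frontier \<Omega>)) s x"
proof -
  obtain \<rho> R c where \<rho>: "0 < \<rho>" and R: "0 < R" and c: "0 < c"
    and ib: "\<And>x. x \<in> \<Omega> \<inter> ball z \<rho> \<Longrightarrow>
      \<exists>y. ball y R \<subseteq> \<Omega> \<and> x \<in> ball y R \<and> c * infdist x (frontier \<Omega>) \<le> R - dist y x"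
    using ball[OF z] by blast
  define K where "K = {x \<in> closure \<Omega>. R / 2 \<le> infdist x (frontier \<Omega>)}"
  have "compact K"
  proof -
    have "closed {x. R / 2 \<le> infdist x (frontier \<Omega>)}"
      by (intro closed_Collect_le continuous_intros)
    then have "compact (closure \<Omega> \<inter> {x. R / 2 \<le> infdist x (frontier \<Omega>)})"
      using bounded_domain by (intro compact_Int_closed) (simp add: compact_closure)
    moreover have "K = closure \<Omega> \<inter> {x. R / 2 \<le> infdist x (frontier \<Omega>)}" by (auto simp: K_def)
    ultimately show ?thesis by simp
  qed
  have K_sub: "K \<subseteq> \<Omega>"
  proof
    fix x assume x: "x \<in> K"
    then have "x \<notin> frontier \<Omega>" using R by (auto simp: K_def)
    then show "x \<in> \<Omega>" using x open_domain by (auto simp: K_def frontier_def interior_open)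
  qed
  have "\<exists>\<kappa>>0. \<forall>x\<in>K. 0 < \<kappa> \<and> fast_growth \<kappa> (s / 2) x"
  proof (rule compact_uniform_constant[OF \<open>compact K\<close>])
    fix y assume "y \<in> K"
    then obtain \<kappa> r where "0 < \<kappa>" "0 < r" "\<forall>x\<in>cball y r. fast_growth \<kappa> (s / 2) x"
      using fast_growth_interior[OF conn x1, of y "s / 2"] K_sub s by (meson half_gt_zero subsetD)
    then show "\<exists>r>0. \<exists>\<kappa>>0. \<forall>x\<in>K \<inter> ball y r. 0 < \<kappa> \<and> fast_growth \<kappa> (s / 2) x"
      by (intro exI[of _ r] conjI exI[of _ \<kappa>]) auto
  next
    fix \<kappa> \<kappa>' x assume "0 < \<kappa> \<and> fast_growth \<kappa> (s / 2) x" "0 < \<kappa>'" "\<kappa>' \<le> \<kappa>"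
    then show "0 < \<kappa>' \<and> fast_growth \<kappa>' (s / 2) x"
      using fast_growth_mono[of \<kappa> "s / 2" x \<kappa>' "s / 2"] by simp
  qed
  then obtain \<kappa> where \<kappa>: "0 < \<kappa>" "\<forall>x\<in>K. fast_growth \<kappa> (s / 2) x" by blast
  have Rs: "0 < R / 2" "R / 2 < R" "0 < s / 2" using R s by auto
  obtain C where C: "0 < C" "\<And>y \<kappa> s' x. 0 \<le> s' \<Longrightarrow> 0 < \<kappa> \<Longrightarrow> ball y R \<subseteq> \<Omega> \<Longrightarrow>
      \<forall>z\<in>cball y (R / 2). fast_growth \<kappa> s' z \<Longrightarrow> x \<in> ball y R \<Longrightarrow>
      fast_growth (\<kappa> * (C * (R - dist y x))) (s' + s / 2) x"
    by (rule fast_growth_propagates[OF Rs], rule that)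
  have "fast_growth (\<kappa> * (C * c) * infdist x (frontier \<Omega>)) s x" if x: "x \<in> \<Omega> \<inter> ball z \<rho>" for x
  proof -
    obtain y where y: "ball y R \<subseteq> \<Omega>" "x \<in> ball y R" "c * infdist x (frontier \<Omega>) \<le> R - dist y x"
      using ib[OF x] by blast
    have "R / 2 < R" using R by simp
    then have y_half: "cball y (R / 2) \<subseteq> ball y R" by (auto intro: le_less_trans)
    have "cball y (R / 2) \<subseteq> K"
    proof
      fix q assume q: "q \<in> cball y (R / 2)"
      then have "q \<in> \<Omega>" using y(1) y_half by blast
      moreover have "R / 2 \<le> infdist q (frontier \<Omega>)"
      proof -
        obtain w where w: "w \<in> frontier \<Omega>" "infdist q (frontier \<Omega>) = dist q w"
          using infdist_attains_inf[OF frontier_closed, of \<Omega> q] z by blast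
        have "w \<notin> ball y R" using w(1) y(1) open_domain by (auto simp: frontier_def interior_open)
        then have "R \<le> dist y q + dist q w" using dist_triangle[of y w q] by (simp add: not_less)
        then show ?thesis using q w(2) by simp
      qed
      ultimately show "q \<in> K" using closure_subset[of \<Omega>] by (simp add: K_def subset_iff)
    qed
    then have "\<forall>q\<in>cball y (R / 2). fast_growth \<kappa> (s / 2) q" using \<kappa>(2) by blast
    moreover have "0 \<le> s / 2" using s by simp
    ultimately have "fast_growth (\<kappa> * (C * (R - dist y x))) (s / 2 + s / 2) x"
      by (intro C(2) \<kappa>(1) y(1,2))
    then show ?thesis
    proof (rule fast_growth_mono)
      have "(\<kappa> * C) * (c * infdist x (frontier \<Omega>)) \<le> (\<kappa> * C) * (R - dist y x)"
        using y(3) by (rule mult_left_mono) (use \<kappa>(1) C(1) in simp)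
      then show "\<kappa> * (C * c) * infdist x (frontier \<Omega>) \<le> \<kappa> * (C * (R - dist y x))"
        by (simp only: mult.assoc)
    qed (use \<kappa>(1) C(1) c in \<open>simp_all add: infdist_nonneg\<close>)
  qed
  moreover have "0 < \<kappa> * (C * c)" using \<kappa> C(1) c by simp
  ultimately show ?thesis
    using \<rho> by (intro exI[of _ \<rho>] exI[of _ "\<kappa> * (C * c)"] conjI ballI)
qed

text \<open>Compactness is applied to the closure, with a predicate vacuous at frontier points. Near
  an interior point the distance is bounded, so a constant rate rescales into a multiple of
  it.\<close>

lemma fast_growth_distance:
  assumes conn: "connected \<Omega>" and x1: "x1 \<in> \<Omega>" "0 < f x1"
    and ball: "\<And>z. z \<in> frontier \<Omega> \<Longrightarrow> \<exists>\<rho>>0. \<exists>R>0. \<exists>c>0. \<forall>x\<in>\<Omega> \<inter> ball z \<rho>.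
      \<exists>y. ball y R \<subseteq> \<Omega> \<and> x \<in> ball y R \<and> c * infdist x (frontier \<Omega>) \<le> R - dist y x"
    and s: "0 < s"
  shows "\<exists>C>0. \<forall>x\<in>\<Omega>. fast_growth (C * infdist x (frontier \<Omega>)) s x"
proof -
  let ?\<delta> = "\<lambda>x. infdist x (frontier \<Omega>)"
  have "\<exists>C>0. \<forall>x\<in>closure \<Omega>. 0 < C \<and> (x \<in> \<Omega> \<longrightarrow> fast_growth (C * ?\<delta> x) s x)"
  proof (rule compact_uniform_constant)
    show "compact (closure \<Omega>)" using bounded_domain by (simp add: compact_closure)
  next
    fix z assume z: "z \<in> closure \<Omega>"
    have "\<exists>r>0. \<exists>C>0. \<forall>x\<in>\<Omega> \<inter> ball z r. fast_growth (C * ?\<delta> x) s x"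
    proof (cases "z \<in> \<Omega>")
      case True
      obtain \<kappa> r where \<kappa>: "0 < \<kappa>" "0 < r" "\<forall>x\<in>cball z r. fast_growth \<kappa> s x"
        using fast_growth_interior[OF conn x1 True s] by blast
      define D where "D = ?\<delta> z + r"
      have D: "0 < D" using \<kappa>(2) infdist_nonneg[of z "frontier \<Omega>"] by (simp add: D_def)
      have "fast_growth (\<kappa> / D * ?\<delta> x) s x" if x: "x \<in> ball z r" for x
      proof (rule fast_growth_mono)
        show "fast_growth \<kappa> s x" using \<kappa>(3) x by simp
        have "?\<delta> x \<le> D"
          using infdist_triangle[of x "frontier \<Omega>" z] x by (simp add: D_def dist_commute)
        then show "\<kappa> / D * ?\<delta> x \<le> \<kappa>" using \<kappa>(1) D by (simp add: field_simps)
      qed (use \<kappa>(1) D in \<open>auto simp: infdist_nonneg\<close>)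
      moreover have "0 < \<kappa> / D" using \<kappa>(1) D by simp
      ultimately show ?thesis using \<kappa>(2) by blast
    next
      case False
      then have zf: "z \<in> frontier \<Omega>" using z open_domain by (simp add: frontier_def interior_open)
      show ?thesis by (rule fast_growth_near_boundary[OF conn x1 ball zf s])
    qed
    then show "\<exists>r>0. \<exists>C>0. \<forall>x\<in>closure \<Omega> \<inter> ball z r. 0 < C \<and> (x \<in> \<Omega> \<longrightarrow> fast_growth (C * ?\<delta> x) s x)"
      by blast
  next
    fix C C' x assume "0 < C \<and> (x \<in> \<Omega> \<longrightarrow> fast_growth (C * ?\<delta> x) s x)" "0 < C'" "C' \<le> C"
    then show "0 < C' \<and> (x \<in> \<Omega> \<longrightarrow> fast_growth (C' * ?\<delta> x) s x)"
      using infdist_nonneg[of x "frontier \<Omega>"]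
        fast_growth_mono[of "C * ?\<delta> x" s x "C' * ?\<delta> x" s] by (simp add: mult_right_mono)
  qed
  then show ?thesis using closure_subset by blast
qed

text \<open>Since \<open>fast_growth\<close> allows increments \<open>h\<close> of any size, no integration in time is needed:
  let \<open>h\<close> tend to \<open>T - t\<close> and use \<open>u < 1\<close>.\<close>

lemma fast_growth_imp_lower_bound:
  assumes fast: "fast_growth \<kappa> s x" and x: "x \<in> \<Omega>" and \<kappa>: "0 \<le> \<kappa>" and t: "0 \<le> t" "s \<le> t" "t < T"
  shows "\<kappa> * (T - t) powr (1 / (p + 1)) \<le> 1 - u x t"
proof (cases "\<kappa> = 0")
  case True
  then show ?thesis using u_less_1[OF subsetD[OF closure_subset x] t(1,3)] by simp
next
  case False
  then have \<kappa>: "0 < \<kappa>" using \<kappa> by simp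
  define w where "w = 1 - u x t"
  have xc: "x \<in> closure \<Omega>" using x closure_subset by blast
  have w: "0 < w" using u_less_1[OF xc t(1,3)] by (simp add: w_def)
  have "T - t \<le> w powr (p + 1) / \<kappa> powr (p + 1)"
  proof (rule dense_le_bounded[of 0])
    fix h assume h: "0 < h" "h < T - t"
    then have "h * \<kappa> powr (p + 1) * w powr (- p) \<le> u x (t + h) - u x t"
      using fast t unfolding fast_growth_def w_def by simp
    also have "\<dots> \<le> w"
      using u_less_1[OF xc, of "t + h"] t h by (simp add: w_def)
    finally have "h * \<kappa> powr (p + 1) * w powr (- p) * w powr p \<le> w * w powr p"
      by (intro mult_right_mono) auto
    moreover have "w powr (- p) * w powr p = 1"
      using w by (simp flip: powr_add)
    moreover have "w * w powr p = w powr (p + 1)"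
      using w by (simp add: powr_add)
    ultimately have "h * \<kappa> powr (p + 1) \<le> w powr (p + 1)"
      by (simp add: mult.assoc)
    then show "h \<le> w powr (p + 1) / \<kappa> powr (p + 1)"
      using \<kappa> by (simp add: pos_le_divide_eq)
  qed (use t in simp)
  then have "(T - t) powr (1 / (p + 1)) \<le> (w powr (p + 1) / \<kappa> powr (p + 1)) powr (1 / (p + 1))"
    using t p_pos by (intro powr_mono2) auto
  also have "\<dots> = w / \<kappa>"
    using w \<kappa> p_pos by (simp add: powr_divide powr_powr)
  finally show ?thesis
    using \<kappa> by (simp add: w_def field_simps)
qed

lemma quenching_rate:
  assumes conn: "connected \<Omega>" and x1: "x1 \<in> \<Omega>" "0 < f x1"
    and ball: "\<And>z. z \<in> frontier \<Omega> \<Longrightarrow> \<exists>\<rho>>0. \<exists>R>0. \<exists>c>0. \<forall>x\<in>\<Omega> \<inter> ball z \<rho>.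
      \<exists>y. ball y R \<subseteq> \<Omega> \<and> x \<in> ball y R \<and> c * infdist x (frontier \<Omega>) \<le> R - dist y x"
  shows "\<exists>\<gamma>>0. \<forall>x\<in>\<Omega>. \<forall>t. 0 < t \<and> t < T \<longrightarrow>
    \<gamma> * infdist x (frontier \<Omega>) * (T - t) powr (1 / (p + 1)) \<le> 1 - u x t"
proof -
  let ?\<delta> = "\<lambda>x. infdist x (frontier \<Omega>)"
  obtain C where C: "0 < C" "\<And>x. x \<in> \<Omega> \<Longrightarrow> fast_growth (C * ?\<delta> x) (T / 2) x"
    using fast_growth_distance[OF conn x1 ball, of "T / 2"] T_pos by auto
  have T2: "T / 2 < T" using T_pos by simp
  obtain m where m: "0 < m" "\<And>x t. x \<in> closure \<Omega> \<Longrightarrow> 0 \<le> t \<Longrightarrow> t \<le> T / 2 \<Longrightarrow> m \<le> 1 - u x t"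
    by (rule u_bounded_away[OF T2], rule that)
  obtain B where B: "0 < B" "\<And>x. x \<in> \<Omega> \<Longrightarrow> norm x \<le> B"
    using bounded_domain unfolding bounded_pos by blast
  define D where "D = ?\<delta> 0 + B"
  have D: "0 < D" using B infdist_nonneg[of 0 "frontier \<Omega>"] by (simp add: D_def)
  have \<delta>D: "?\<delta> x \<le> D" if "x \<in> \<Omega>" for x
    using infdist_triangle[of x "frontier \<Omega>" 0] B(2)[OF that] by (simp add: D_def)
  \<comment> \<open>\<open>E\<close> bounds the product of distance and time factor, so
    \<open>m / E\<close> covers the times before \<open>T / 2\<close>, where
    \<open>1 - u \<ge> m\<close>; \<open>C\<close> covers the later ones.\<close>
  define E where "E = D * T powr (1 / (p + 1))"
  have E: "0 < E" using D T_pos by (simp add: E_def)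
  define \<gamma> where "\<gamma> = min C (m / E)"
  have "\<gamma> * ?\<delta> x * (T - t) powr (1 / (p + 1)) \<le> 1 - u x t"
    if x: "x \<in> \<Omega>" and t: "0 < t" "t < T" for x t
  proof (cases "T / 2 \<le> t")
    case True
    have "\<gamma> * ?\<delta> x * (T - t) powr (1 / (p + 1)) \<le> C * ?\<delta> x * (T - t) powr (1 / (p + 1))"
      by (intro mult_right_mono) (auto simp: \<gamma>_def infdist_nonneg)
    also have "\<dots> \<le> 1 - u x t"
      by (rule fast_growth_imp_lower_bound[OF C(2)[OF x] x]) (use t True C(1) in \<open>simp_all add: infdist_nonneg\<close>)
    finally show ?thesis .
  next
    case False
    have "?\<delta> x * (T - t) powr (1 / (p + 1)) \<le> E"
      unfolding E_def using \<delta>D[OF x] t p_pos D by (intro mult_mono powr_mono2) (auto simp: infdist_nonneg)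
    then have "\<gamma> * (?\<delta> x * (T - t) powr (1 / (p + 1))) \<le> m / E * E"
      using m(1) E by (intro mult_mono) (auto simp: \<gamma>_def infdist_nonneg)
    also have "\<dots> \<le> 1 - u x t"
      using m(2)[of x t] x t False E closure_subset by auto
    finally show ?thesis by (simp add: mult.assoc)
  qed
  moreover have "0 < \<gamma>" using C(1) m(1) E by (simp add: \<gamma>_def)
  ultimately show ?thesis by blast
qed

end

section \<open>From the stated problem to the locale\<close>

lemma holder_on_imp_continuous_on:
  assumes "holder_on \<alpha> S g" "0 < \<alpha>"
  shows "continuous_on S g"
  unfolding continuous_on_def
proof
  fix x assume "x \<in> S"
  obtain C where C: "\<And>x y. x \<in> S \<Longrightarrow> y \<in> S \<Longrightarrow> \<bar>g x - g y\<bar> \<le> C * dist x y powr \<alpha>"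
    using assms(1) unfolding holder_on_def by blast
  have "((\<lambda>y. dist y x) \<longlongrightarrow> dist x x) (at x within S)"
    by (rule tendsto_dist[OF tendsto_ident_at tendsto_const])
  then have "((\<lambda>y. dist y x) \<longlongrightarrow> 0) (at x within S)" by simp
  then have "((\<lambda>y. C * dist y x powr \<alpha>) \<longlongrightarrow> C * 0) (at x within S)"
    by (intro tendsto_mult_left tendsto_zero_powrI[where b = \<alpha>]) (use assms(2) in simp_all)
  then have lim: "((\<lambda>y. C * dist y x powr \<alpha>) \<longlongrightarrow> 0) (at x within S)" by simp
  have "\<forall>\<^sub>F y in at x within S. norm (g y - g x) \<le> C * dist y x powr \<alpha>"
    unfolding eventually_at_filter
    by (rule always_eventually) (use C[OF _ \<open>x \<in> S\<close>] in simp)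
  from Lim_null_comparison[OF this lim] show "(g \<longlongrightarrow> g x) (at x within S)"
    by (subst Lim_null)
qed

theorem theorem2:
  fixes \<Omega> :: "(real ^ 'n) set"
    and f :: "real ^ 'n \<Rightarrow> real"
    and u :: "real ^ 'n \<Rightarrow> real \<Rightarrow> real"
    and \<nu> \<alpha> p :: real
    and T :: ereal
  assumes "open \<Omega>" and "connected \<Omega>" and "\<Omega> \<noteq> {}" and "bounded \<Omega>"
    and "0 < \<nu>" and "\<nu> \<le> 1" and "C2_holder_boundary \<nu> \<Omega>"
    and "0 < p"
    and "0 < \<alpha>" and "\<alpha> \<le> 1" and "holder_on \<alpha> (closure \<Omega>) f"
    and "\<forall>x\<in>closure \<Omega>. 0 \<le> f x"
    and "\<exists>x\<in>closure \<Omega>. f x \<noteq> 0"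
    and "maximal_classical_solution \<Omega> p f u T"
    and "T < \<infinity>"
  shows "\<exists>\<gamma>>0. \<forall>x\<in>\<Omega>. \<forall>t. 0 < t \<and> ereal t < T \<longrightarrow>
    1 - u x t \<ge> \<gamma> * infdist x (frontier \<Omega>) * (real_of_ereal T - t) powr (1 / (p + 1))"
proof -
  have sol: "classical_solution \<Omega> p f u T"
    using assms unfolding maximal_classical_solution_def by blast
  then have "0 < T" unfolding classical_solution_def by blast
  define S where "S = real_of_ereal T"
  have T: "T = ereal S" "0 < S"
    using \<open>0 < T\<close> \<open>T < \<infinity>\<close> by (cases T; simp add: S_def)+
  have f_cont: "continuous_on (closure \<Omega>) f"
    using assms by (intro holder_on_imp_continuous_on)
  have C21: "C21_on (\<Omega> \<times> {t. 0 < t \<and> t < S}) u"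
    using sol unfolding classical_solution_def T by simp
  have lap: "has_laplacian (\<lambda>y. u y t) x (laplacian (\<lambda>y. u y t) x)"
    if "x \<in> \<Omega>" "0 < t" "t < S" for x t
    by (rule has_laplacian_laplacian[OF \<open>open \<Omega>\<close> that(1)])
      (use C21 that in \<open>auto simp: C21_on_def\<close>)
  have der: "(u x has_real_derivative laplacian (\<lambda>y. u y t) x + f x * (1 - u x t) powr (- p)) (at t)"
    if "x \<in> \<Omega>" "0 < t" "t < S" for x t
  proof -
    have "u x field_differentiable (at t)" using C21 that by (auto simp: C21_on_def)
    moreover have "deriv (u x) t = laplacian (\<lambda>y. u y t) x + f x * (1 - u x t) powr (- p)"
      using sol that unfolding classical_solution_def T by simp
    ultimately show ?thesis by (metis field_differentiable_derivI)
  qed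
  have "{t. 0 \<le> t \<and> t < S} = {0..<S}" by auto
  then have u_cont: "continuous_on (closure \<Omega> \<times> {0..<S}) (\<lambda>(x, t). u x t)"
    using sol unfolding classical_solution_def T by simp
  have u_lt: "u x t < 1" if "x \<in> closure \<Omega>" "0 \<le> t" "t < S" for x t
    using sol that unfolding classical_solution_def T by simp
  have u_bd: "u x t = 0" if "x \<in> frontier \<Omega>" "0 < t" "t < S" for x t
    using sol that unfolding classical_solution_def T by simp
  have u_0: "u x 0 = 0" if "x \<in> \<Omega>" for x
    using sol that unfolding classical_solution_def T by simp
  interpret quenching \<Omega> p f u S
    by (rule quenching.intro) (fact assms(1,4,8) T(2) assms(12)[rule_format] f_cont u_cont u_lt der lap u_bd u_0)+
  \<comment> \<open>The nonzero value is given on the closure only; vanishing inside would extend to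
    the closure by continuity.\<close>
  have "\<exists>x\<in>\<Omega>. 0 < f x"
  proof (rule ccontr)
    assume no: "\<not> (\<exists>x\<in>\<Omega>. 0 < f x)"
    have f0: "f x = 0" if "x \<in> \<Omega>" for x
      using no f_nonneg[OF subsetD[OF closure_subset that]] that by force
    have "f x = 0" if "x \<in> closure \<Omega>" for x
      by (rule continuous_constant_on_closure[OF f_cont f0 that])
    then show False using assms(13) by blast
  qed
  then obtain x1 where x1: "x1 \<in> \<Omega>" "0 < f x1" by blast
  have "\<exists>\<gamma>>0. \<forall>x\<in>\<Omega>. \<forall>t. 0 < t \<and> t < S \<longrightarrow>
      \<gamma> * infdist x (frontier \<Omega>) * (S - t) powr (1 / (p + 1)) \<le> 1 - u x t"
    by (rule quenching_rate[OF assms(2) x1]) (rule C2_holder_boundary_interior_ball[OF assms(1,7,5)])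
  then show ?thesis by (simp add: T)
qed

end
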